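(* Let $(M,\mathcal{X})\models \mathrm{RCA}^*_0$ and let $I\subseteq M$ be a proper cut of $M$ that is $\Sigma^0_1$-definable in $(M,\mathcal{X})$ (with parameters). Then for every $n,k\in\omega$: \[(M,\mathcal{X})\models \mathrm{RT}^n_k \quad\text{iff}\quad (I,\mathrm{Cod}(M/I))\models \mathrm{RT}^n_k.\]
   Context: $\mathrm{RCA}^*_0$ is the second-order arithmetic theory with the basic axioms, induction for $\Delta^0_0$ formulas, $\Sigma^0_1$ collection ($\mathrm{B}\Sigma^0_1$), the axiom $\exp$ asserting that $2^x$ is total, and $\Delta^0_1$ comprehension. $\mathrm{RT}^n_k$ is the statement: for every function $f\colon[\mathbb{N}]^n\to k$ there is an infinite set $H$ homogeneous for $f$, where "infinite" means unbounded (for every $x$ there is $y\in H$ with $y\ge x$). A cut of $M$ is a subset containing $0$, closed downwards and under successor; it is proper if it is not all of $M$. For $s\in M$, $(s)_{\mathrm{Ack}}=\{a\in M: \text{the } a\text{-th bit of the binary expansion of } s \text{ is } 1\}$. $\mathrm{Cod}(M/I)=\{(s)_{\mathrm{Ack}}\cap I: s\in M\}$, the subsets of $I$ coded in $M$; by abuse this also includes relations/functions on $I$ coded in $M$ via the Cantor pairing function (e.g. a colouring $f\colon[I]^n\to k$ is in $\mathrm{Cod}(M/I)$ if its graph restricted to tuples from $I$ equals $(s)_{\mathrm{Ack}}$ intersected with codes of such tuples for some $s\in M$). $(I,\mathrm{Cod}(M/I))\models\mathrm{RT}^n_k$ means: for every $f\colon[I]^n\to k$ in $\mathrm{Cod}(M/I)$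 there is $H\in\mathrm{Cod}(M/I)$ cofinal in $I$ and homogeneous for $f$. *)

theory Defs
  imports Main
begin

section \<open>Structures for second-order arithmetic\<close>

text \<open>The first-order universe is the whole type \<open>'a\<close>; \<open>setsM\<close> is the range of the set variables.\<close>

record 'a L2_structure =
  zeroM :: 'a ("\<zero>\<index>")
  oneM :: 'a ("\<one>\<index>")
  addM :: "'a \<Rightarrow> 'a \<Rightarrow> 'a" (infixl "\<oplus>\<index>" 65)
  mulM :: "'a \<Rightarrow> 'a \<Rightarrow> 'a" (infixl "\<otimes>\<index>" 70)
  lessM :: "'a \<Rightarrow> 'a \<Rightarrow> bool" (infix "\<prec>\<index>" 50)
  setsM :: "'a set set"

section \<open>Formulas\<close>

text \<open>
  Number variables are de Bruijn indices, looked up in an environment \<open>e\<close>; set variables are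
  free names, looked up in \<open>E\<close>. In \<open>BEx t \<phi>\<close> and \<open>BAll t \<phi>\<close> the bound \<open>t\<close> is evaluated outside the
  scope of the quantifier, so the bound variable cannot occur in it.
\<close>

datatype tm = Var nat | Zero | One | Add tm tm | Mul tm tm

datatype delta0 =
    Eq tm tm
  | Less tm tm
  | Mem tm nat
  | Neg delta0
  | Conj delta0 delta0
  | Disj delta0 delta0
  | BEx tm delta0
  | BAll tm delta0

abbreviation push :: "'a \<Rightarrow> (nat \<Rightarrow> 'a) \<Rightarrow> nat \<Rightarrow> 'a" (infixr "\<triangleright>" 60) where
  "x \<triangleright> e \<equiv> case_nat x e"

primrec eval :: "('a, 'b) L2_structure_scheme \<Rightarrow> (nat \<Rightarrow> 'a) \<Rightarrow> tm \<Rightarrow> 'a" where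
  "eval M e (Var i) = e i"
| "eval M e Zero = \<zero>\<^bsub>M\<^esub>"
| "eval M e One = \<one>\<^bsub>M\<^esub>"
| "eval M e (Add s t) = eval M e s \<oplus>\<^bsub>M\<^esub> eval M e t"
| "eval M e (Mul s t) = eval M e s \<otimes>\<^bsub>M\<^esub> eval M e t"

primrec sat :: "('a, 'b) L2_structure_scheme \<Rightarrow> (nat \<Rightarrow> 'a) \<Rightarrow> (nat \<Rightarrow> 'a set) \<Rightarrow> delta0 \<Rightarrow> bool" where
  "sat M e E (Eq s t) \<longleftrightarrow> eval M e s = eval M e t"
| "sat M e E (Less s t) \<longleftrightarrow> eval M e s \<prec>\<^bsub>M\<^esub> eval M e t"
| "sat M e E (Mem t j) \<longleftrightarrow> eval M e t \<in> E j"
| "sat M e E (Neg \<phi>) \<longleftrightarrow> \<not> sat M e E \<phi>"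
| "sat M e E (Conj \<phi> \<psi>) \<longleftrightarrow> sat M e E \<phi> \<and> sat M e E \<psi>"
| "sat M e E (Disj \<phi> \<psi>) \<longleftrightarrow> sat M e E \<phi> \<or> sat M e E \<psi>"
| "sat M e E (BEx t \<phi>) \<longleftrightarrow> (\<exists>x. x \<prec>\<^bsub>M\<^esub> eval M e t \<and> sat M (x \<triangleright> e) E \<phi>)"
| "sat M e E (BAll t \<phi>) \<longleftrightarrow> (\<forall>x. x \<prec>\<^bsub>M\<^esub> eval M e t \<longrightarrow> sat M (x \<triangleright> e) E \<phi>)"

text \<open>
  A \<open>\<Sigma>\<^sup>0\<^sub>1\<close> (\<open>\<Pi>\<^sup>0\<^sub>1\<close>) formula is an unbounded existential (universal) number quantifier in front of
  a \<open>\<Delta>\<^sup>0\<^sub>0\<close> matrix; it is represented by its matrix, in which index 0 is the quantified variable.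
\<close>

definition sat_Sigma1 :: "('a, 'b) L2_structure_scheme \<Rightarrow> (nat \<Rightarrow> 'a) \<Rightarrow> (nat \<Rightarrow> 'a set) \<Rightarrow> delta0 \<Rightarrow> bool" where
  "sat_Sigma1 M e E \<phi> \<longleftrightarrow> (\<exists>z. sat M (z \<triangleright> e) E \<phi>)"

definition sat_Pi1 :: "('a, 'b) L2_structure_scheme \<Rightarrow> (nat \<Rightarrow> 'a) \<Rightarrow> (nat \<Rightarrow> 'a set) \<Rightarrow> delta0 \<Rightarrow> bool" where
  "sat_Pi1 M e E \<phi> \<longleftrightarrow> (\<forall>z. sat M (z \<triangleright> e) E \<phi>)"

definition set_env :: "('a, 'b) L2_structure_scheme \<Rightarrow> (nat \<Rightarrow> 'a set) \<Rightarrow> bool" where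
  "set_env M E \<longleftrightarrow> (\<forall>j. E j \<in> setsM M)"

definition Sigma1_definable :: "('a, 'b) L2_structure_scheme \<Rightarrow> 'a set \<Rightarrow> bool" where
  "Sigma1_definable M A \<longleftrightarrow>
     (\<exists>\<phi> e E. set_env M E \<and> A = {x. sat_Sigma1 M (x \<triangleright> e) E \<phi>})"

section \<open>Powers of two\<close>

text \<open>\<open>beta M a b i r\<close>: \<open>r\<close> is the value of Goedel's beta function at \<open>i\<close>, \<open>a mod (1 + (i + 1) b)\<close>.\<close>

definition beta :: "('a, 'b) L2_structure_scheme \<Rightarrow> 'a \<Rightarrow> 'a \<Rightarrow> 'a \<Rightarrow> 'a \<Rightarrow> bool" where
  "beta M a b i r \<longleftrightarrow>
     (\<exists>q. a = q \<otimes> (\<one> \<oplus> (i \<oplus> \<one>) \<otimes> b) \<oplus> r) \<and> r \<prec> \<one> \<oplus> (i \<oplus> \<one>) \<otimes> b"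
  for M (structure)

text \<open>
  \<open>pow2 M x y\<close> is the arithmetical graph \<open>y = 2\<^sup>x\<close>: some beta-coded sequence starts with 1, doubles
  at each of its first \<open>x\<close> steps, and has \<open>y\<close> as its \<open>x\<close>-th entry.
\<close>

definition pow2 :: "('a, 'b) L2_structure_scheme \<Rightarrow> 'a \<Rightarrow> 'a \<Rightarrow> bool" where
  "pow2 M x y \<longleftrightarrow>
     (\<exists>a b. beta M a b \<zero> \<one> \<and>
            (\<forall>i. i \<prec> x \<longrightarrow> (\<exists>r. beta M a b i r \<and> beta M a b (i \<oplus> \<one>) ((\<one> \<oplus> \<one>) \<otimes> r))) \<and>
            beta M a b x y)"
  for M (structure)

section \<open>The theory \<open>RCA\<^sup>*\<^sub>0\<close>\<close>

definition basic_axioms :: "('a, 'b) L2_structure_scheme \<Rightarrow> bool" where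
  "basic_axioms M \<longleftrightarrow>
     (\<forall>x. x \<oplus> \<one> \<noteq> \<zero>) \<and>
     (\<forall>x y. x \<oplus> \<one> = y \<oplus> \<one> \<longrightarrow> x = y) \<and>
     (\<forall>x. x \<oplus> \<zero> = x) \<and>
     (\<forall>x y. x \<oplus> (y \<oplus> \<one>) = (x \<oplus> y) \<oplus> \<one>) \<and>
     (\<forall>x. x \<otimes> \<zero> = \<zero>) \<and>
     (\<forall>x y. x \<otimes> (y \<oplus> \<one>) = x \<otimes> y \<oplus> x) \<and>
     (\<forall>x. \<not> x \<prec> \<zero>) \<and>
     (\<forall>x y. x \<prec> y \<oplus> \<one> \<longleftrightarrow> x \<prec> y \<or> x = y)"
  for M (structure)

definition Delta0_induction :: "('a, 'b) L2_structure_scheme \<Rightarrow> bool" where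
  "Delta0_induction M \<longleftrightarrow>
     (\<forall>\<phi> e E. set_env M E \<longrightarrow>
        sat M (\<zero> \<triangleright> e) E \<phi> \<longrightarrow>
        (\<forall>x. sat M (x \<triangleright> e) E \<phi> \<longrightarrow> sat M ((x \<oplus> \<one>) \<triangleright> e) E \<phi>) \<longrightarrow>
        (\<forall>x. sat M (x \<triangleright> e) E \<phi>))"
  for M (structure)

definition Sigma1_collection :: "('a, 'b) L2_structure_scheme \<Rightarrow> bool" where
  "Sigma1_collection M \<longleftrightarrow>
     (\<forall>\<phi> e E a. set_env M E \<longrightarrow>
        (\<forall>x. x \<prec> a \<longrightarrow> (\<exists>y. sat_Sigma1 M (y \<triangleright> x \<triangleright> e) E \<phi>)) \<longrightarrow>
        (\<exists>b. \<forall>x. x \<prec> a \<longrightarrow> (\<exists>y. y \<prec> b \<and> sat_Sigma1 M (y \<triangleright> x \<triangleright> e) E \<phi>)))"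
  for M (structure)

definition exp_total :: "('a, 'b) L2_structure_scheme \<Rightarrow> bool" where
  "exp_total M \<longleftrightarrow> (\<forall>x. \<exists>y. pow2 M x y)"

definition Delta1_comprehension :: "('a, 'b) L2_structure_scheme \<Rightarrow> bool" where
  "Delta1_comprehension M \<longleftrightarrow>
     (\<forall>\<phi> \<psi> e E. set_env M E \<longrightarrow>
        (\<forall>x. sat_Sigma1 M (x \<triangleright> e) E \<phi> \<longleftrightarrow> sat_Pi1 M (x \<triangleright> e) E \<psi>) \<longrightarrow>
        {x. sat_Sigma1 M (x \<triangleright> e) E \<phi>} \<in> setsM M)"

text \<open>
  Environments are total, so the usual convention that each sort of a structure is nonempty has to
  be stated for the sets.
\<close>

definition RCA0_star :: "('a, 'b) L2_structure_scheme \<Rightarrow> bool" where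
  "RCA0_star M \<longleftrightarrow>
     setsM M \<noteq> {} \<and> basic_axioms M \<and> Delta0_induction M \<and> Sigma1_collection M \<and>
     exp_total M \<and> Delta1_comprehension M"

section \<open>Cuts and coded sets\<close>

definition proper_cut :: "('a, 'b) L2_structure_scheme \<Rightarrow> 'a set \<Rightarrow> bool" where
  "proper_cut M I \<longleftrightarrow>
     \<zero> \<in> I \<and> (\<forall>x\<in>I. \<forall>y. y \<prec> x \<longrightarrow> y \<in> I) \<and> (\<forall>x\<in>I. x \<oplus> \<one> \<in> I) \<and> I \<noteq> UNIV"
  for M (structure)

text \<open>Bit \<open>a\<close> of \<open>s\<close> is 1 iff \<open>s = (2 q + 1) 2\<^sup>a + r\<close> for some \<open>q\<close> and some \<open>r < 2\<^sup>a\<close>.\<close>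

definition Ack :: "('a, 'b) L2_structure_scheme \<Rightarrow> 'a \<Rightarrow> 'a set" where
  "Ack M s = {a. \<exists>p q r. pow2 M a p \<and> r \<prec> p \<and> s = ((\<one> \<oplus> \<one>) \<otimes> q \<oplus> \<one>) \<otimes> p \<oplus> r}"
  for M (structure)

definition Cod :: "('a, 'b) L2_structure_scheme \<Rightarrow> 'a set \<Rightarrow> 'a set set" where
  "Cod M I = {Ack M s \<inter> I | s. True}"

text \<open>The Cantor pairing function \<open>(x + y) (x + y + 1) / 2 + y\<close>.\<close>

definition pair :: "('a, 'b) L2_structure_scheme \<Rightarrow> 'a \<Rightarrow> 'a \<Rightarrow> 'a" where
  "pair M x y = (THE z. (\<one> \<oplus> \<one>) \<otimes> z = (x \<oplus> y) \<otimes> (x \<oplus> y \<oplus> \<one>) \<oplus> (\<one> \<oplus> \<one>) \<otimes> y)"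
  for M (structure)

fun tuple :: "('a, 'b) L2_structure_scheme \<Rightarrow> 'a list \<Rightarrow> 'a" where
  "tuple M [] = \<zero>\<^bsub>M\<^esub>"
| "tuple M [x] = x"
| "tuple M (x # y # ys) = pair M x (tuple M (y # ys))"

section \<open>Ramsey's theorem\<close>

text \<open>\<open>[A]\<^sup>n\<close>, with an \<open>n\<close>-element set represented by its increasing enumeration.\<close>

definition subsets_of_size :: "('a, 'b) L2_structure_scheme \<Rightarrow> 'a set \<Rightarrow> nat \<Rightarrow> 'a list set" where
  "subsets_of_size M A n = {xs. length xs = n \<and> set xs \<subseteq> A \<and> sorted_wrt (lessM M) xs}"

definition std :: "('a, 'b) L2_structure_scheme \<Rightarrow> nat \<Rightarrow> 'a" where
  "std M c = ((\<lambda>x. x \<oplus> \<one>) ^^ c) \<zero>"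
  for M (structure)

definition colouring_graph ::
  "('a, 'b) L2_structure_scheme \<Rightarrow> 'a set \<Rightarrow> nat \<Rightarrow> ('a list \<Rightarrow> nat) \<Rightarrow> 'a set" where
  "colouring_graph M A n f = {tuple M (xs @ [std M (f xs)]) | xs. xs \<in> subsets_of_size M A n}"

text \<open>
  \<open>RT\<^sup>n\<^sub>k\<close> with number quantifiers over \<open>A\<close>, set quantifiers over \<open>\<S>\<close>, and colourings of \<open>[A]\<^sup>n\<close>
  restricted to those satisfying \<open>\<F>\<close>.
\<close>

definition ramsey ::
  "('a, 'b) L2_structure_scheme \<Rightarrow> 'a set \<Rightarrow> 'a set set \<Rightarrow> (('a list \<Rightarrow> nat) \<Rightarrow> bool) \<Rightarrow> nat \<Rightarrow> nat \<Rightarrow> bool" where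
  "ramsey M A \<S> \<F> n k \<longleftrightarrow>
     (\<forall>f. (\<forall>xs \<in> subsets_of_size M A n. f xs < k) \<longrightarrow> \<F> f \<longrightarrow>
        (\<exists>H\<in>\<S>. H \<subseteq> A \<and>
               (\<forall>x\<in>A. \<exists>y\<in>H. x \<prec> y \<or> x = y) \<and>
               (\<exists>c<k. \<forall>xs \<in> subsets_of_size M H n. f xs = c)))"
  for M (structure)

definition models_RT :: "('a, 'b) L2_structure_scheme \<Rightarrow> nat \<Rightarrow> nat \<Rightarrow> bool" where
  "models_RT M n k \<longleftrightarrow>
     ramsey M UNIV (setsM M) (\<lambda>f. colouring_graph M UNIV n f \<in> setsM M) n k"

text \<open>
  A cut need not be closed under pairing, so a colouring in \<open>Cod M I\<close> is one whose graph is cut out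
  by some \<open>Ack M s\<close> among the codes of all \<open>(n + 1)\<close>-tuples from \<open>I\<close>; these codes may lie outside \<open>I\<close>.
\<close>

definition coded_colouring ::
  "('a, 'b) L2_structure_scheme \<Rightarrow> 'a set \<Rightarrow> nat \<Rightarrow> ('a list \<Rightarrow> nat) \<Rightarrow> bool" where
  "coded_colouring M I n f \<longleftrightarrow>
     (\<exists>s. colouring_graph M I n f =
            Ack M s \<inter> tuple M ` {ys. length ys = n + 1 \<and> set ys \<subseteq> I})"

definition cut_models_RT :: "('a, 'b) L2_structure_scheme \<Rightarrow> 'a set \<Rightarrow> nat \<Rightarrow> nat \<Rightarrow> bool" where
  "cut_models_RT M I n k \<longleftrightarrow> ramsey M I (Cod M I) (coded_colouring M I n) n k"

end

theory Submission
  imports Defs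
begin

text \<open>
  A \<open>\<Sigma>\<^sup>0\<^sub>1\<close>-definition of a proper cut \<open>I\<close> has unbounded witnesses, so bounding the witnesses of all
  \<open>j \<le> i\<close> gives a \<open>\<Delta>\<^sup>0\<^sub>1\<close> increasing map \<open>g\<close> from \<open>I\<close> cofinally into \<open>M\<close>, together with a \<open>\<Delta>\<^sup>0\<^sub>1\<close>
  map \<open>idx\<close> from \<open>M\<close> to \<open>I\<close>, where \<open>idx x\<close> is the least \<open>i\<close> with \<open>g i \<ge> x\<close>. Colourings are pulled back
  along \<open>g\<close> and \<open>idx\<close>, and homogeneous sets are sent to their images under the same map. From
  \<open>I\<close> to \<open>M\<close> the results are sets of the structure by \<open>\<Delta>\<^sup>0\<^sub>1\<close> comprehension. From \<open>M\<close> to \<open>I\<close> they are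
  coded because of the Chong--Mourad lemma: if a bounded \<open>\<Sigma>\<^sup>0\<^sub>1\<close> set splits into two
  \<open>\<Sigma>\<^sup>0\<^sub>1\<close> parts, then some \<open>s\<close> codes one of them relative to the whole.
\<close>

section \<open>Definability\<close>

text \<open>The obstacle is that \<open>I\<close> is only Sigma1: it is no set of the structure, and
  induction fails for it. So \<open>I\<close> is handled through the graph \<open>G\<close> of the
  enumeration, arranged to be Delta0 and to satisfy \<open>i \<preceq> w\<close> whenever
  \<open>G i w\<close>; this inequality bounds the search for a preimage, so that \<open>idx\<close>
  and images under \<open>g\<close> become Delta0 as well. Membership of \<open>i\<close> in a
  subset of \<open>I\<close> obtained from \<open>M\<close> is decided once the value
  \<open>g i\<close> has been found. Membership and non-membership are then both Sigma1 on
  \<open>I\<close>, but as \<open>g\<close> is cofinal in \<open>M\<close> the witnesses need not be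
  bounded over \<open>I\<close>, and coding by Delta0 induction is out of reach. The Chong--Mourad
  lemma replaces it by collection over all candidate codes below a power of two, a range that exists
  by exp. As \<open>g\<close> is strictly increasing and \<open>idx\<close> only weakly, pulling
  back along \<open>idx\<close> also calls for a default colour. Definability is semantic:
  \<open>dfn\<close> admits every set of the structure as a parameter, so a Delta1 set, once formed,
  may occur in later Delta0 formulas; the graph of \<open>2^x\<close> enters in this way.\<close>

primrec ren_tm :: "(nat \<Rightarrow> nat) \<Rightarrow> tm \<Rightarrow> tm" where
  "ren_tm r (Var i) = Var (r i)"
| "ren_tm r Zero = Zero"
| "ren_tm r One = One"
| "ren_tm r (Add s t) = Add (ren_tm r s) (ren_tm r t)"
| "ren_tm r (Mul s t) = Mul (ren_tm r s) (ren_tm r t)"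

definition lift :: "(nat \<Rightarrow> nat) \<Rightarrow> nat \<Rightarrow> nat" where
  "lift r = case_nat 0 (\<lambda>i. Suc (r i))"

primrec ren :: "(nat \<Rightarrow> nat) \<Rightarrow> (nat \<Rightarrow> nat) \<Rightarrow> delta0 \<Rightarrow> delta0" where
  "ren r s (Eq t u) = Eq (ren_tm r t) (ren_tm r u)"
| "ren r s (Less t u) = Less (ren_tm r t) (ren_tm r u)"
| "ren r s (Mem t j) = Mem (ren_tm r t) (s j)"
| "ren r s (Neg \<phi>) = Neg (ren r s \<phi>)"
| "ren r s (Conj \<phi> \<psi>) = Conj (ren r s \<phi>) (ren r s \<psi>)"
| "ren r s (Disj \<phi> \<psi>) = Disj (ren r s \<phi>) (ren r s \<psi>)"
| "ren r s (BEx t \<phi>) = BEx (ren_tm r t) (ren (lift r) s \<phi>)"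
| "ren r s (BAll t \<phi>) = BAll (ren_tm r t) (ren (lift r) s \<phi>)"

lemma eval_ren: "eval M e (ren_tm r t) = eval M (\<lambda>i. e (r i)) t"
  by (induction t) auto

lemma push_lift: "(\<lambda>i. (x \<triangleright> e) (lift r i)) = x \<triangleright> (\<lambda>i. e (r i))"
  by (auto simp: lift_def split: nat.splits)

lemma sat_ren: "sat M e E (ren r s \<phi>) \<longleftrightarrow> sat M (\<lambda>i. e (r i)) (\<lambda>j. E (s j)) \<phi>"
  by (induction \<phi> arbitrary: e r) (simp_all add: eval_ren push_lift)

text \<open>Interleaving makes room for two infinite families at once, so parameter families can be
  merged without knowing how many entries a formula uses.\<close>

definition ilv :: "(nat \<Rightarrow> 'c) \<Rightarrow> (nat \<Rightarrow> 'c) \<Rightarrow> nat \<Rightarrow> 'c" where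
  "ilv e p i = (if even i then e (i div 2) else p (i div 2))"

lemma ilv_even [simp]: "ilv e p (2 * i) = e i"
  and ilv_odd [simp]: "ilv e p (Suc (2 * i)) = p i"
  by (auto simp: ilv_def)

text \<open>The entry \<open>p j\<close> sits at index \<open>2 * j + 1\<close> of
  \<open>ilv e p\<close>, and at \<open>2 * (2 * j) + 1\<close> once the parameters are
  merged.\<close>

lemma ilv_left: "(\<lambda>i. ilv e (ilv p q) (if even i then i else 2 * i - 1)) = ilv e p"
proof
  fix i
  show "ilv e (ilv p q) (if even i then i else 2 * i - 1) = ilv e p i"
  proof (cases "even i")
    case False
    then obtain j where i: "i = Suc (2 * j)" by (auto elim: oddE)
    then have "2 * i - 1 = Suc (2 * (2 * j))" by simp
    with i False show ?thesis by (simp only: ilv_odd ilv_even if_False)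
  qed (simp add: ilv_def)
qed

lemma ilv_right: "(\<lambda>i. ilv e (ilv p q) (if even i then i else 2 * i + 1)) = ilv e q"
proof
  fix i
  show "ilv e (ilv p q) (if even i then i else 2 * i + 1) = ilv e q i"
  proof (cases "even i")
    case False
    then obtain j where i: "i = Suc (2 * j)" by (auto elim: oddE)
    then have "2 * i + 1 = Suc (2 * Suc (2 * j))" by simp
    with i False show ?thesis by (simp only: ilv_odd ilv_even if_False)
  qed (simp add: ilv_def)
qed

text \<open>Pushing a bound variable shifts all indices by one and so exchanges the parities; this
  renaming restores the layout with parameters at odd indices.\<close>

lemma ilv_push:
  "(\<lambda>i. (x \<triangleright> ilv e p) (if i = 0 then 0 else if even i then i - 1 else Suc i)) = ilv (x \<triangleright> e) p"
proof
  fix i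
  consider "i = 0" | j where "i = 2 * Suc j" | j where "i = Suc (2 * j)"
    by (cases "even i") (metis dvd_def mult_0_right old.nat.exhaust, metis oddE Suc_eq_plus1)
  then show "(x \<triangleright> ilv e p) (if i = 0 then 0 else if even i then i - 1 else Suc i) = ilv (x \<triangleright> e) p i"
  proof cases
    case 1
    then show ?thesis using ilv_even[of "x \<triangleright> e" p 0] by simp
  next
    case (2 j)
    then have "i - 1 = Suc (2 * j)" "i = 2 * Suc j" by simp_all
    then show ?thesis by (simp only: ilv_even) simp
  next
    case (3 j)
    then show ?thesis by simp
  qed
qed

text \<open>Leads from the interleaved layout to that of the axioms, with \<open>z\<close> and
  \<open>x\<close> in front of the parameters. All other even indices read the dummy
  \<open>c\<close>.\<close>

lemma ilv_params:
  "(\<lambda>i. (z \<triangleright> x \<triangleright> c \<triangleright> p) (if i = 0 then 0 else if i = 2 then 1 else if even i then 2 else i div 2 + 3))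
   = ilv (z \<triangleright> x \<triangleright> (\<lambda>_. c)) p"
proof
  fix i :: nat
  consider "i = 0" | "i = 2" | j where "i = 2 * Suc (Suc j)" | j where "i = Suc (2 * j)"
    by (cases "even i") (metis dvd_def mult_0_right mult_1_right old.nat.exhaust One_nat_def, metis oddE Suc_eq_plus1)
  then show "(z \<triangleright> x \<triangleright> c \<triangleright> p) (if i = 0 then 0 else if i = 2 then 1 else if even i then 2 else i div 2 + 3)
      = ilv (z \<triangleright> x \<triangleright> (\<lambda>_. c)) p i"
  proof cases
    case (3 j)
    then have "i \<noteq> 0" "i \<noteq> 2" "even i" "i div 2 = Suc (Suc j)" by auto
    then show ?thesis by (simp add: ilv_def numeral_eq_Suc)
  next
    case (4 j)
    then have "i \<noteq> 0" "i \<noteq> 2" "odd i" "i div 2 = j" by auto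
    then show ?thesis by (simp add: ilv_def numeral_eq_Suc)
  qed (simp_all add: ilv_def numeral_eq_Suc)
qed

section \<open>Closure properties of Delta0 predicates with parameters\<close>

locale rca =
  fixes M :: "('a, 'b) L2_structure_scheme" (structure)
  assumes rca: "RCA0_star M"
begin

text \<open>Functions given by terms are kept apart because only terms may bound a quantifier in the
  syntax.\<close>

definition tmf :: "((nat \<Rightarrow> 'a) \<Rightarrow> 'a) \<Rightarrow> bool" where
  "tmf f \<longleftrightarrow> (\<exists>t p. \<forall>e. f e = eval M (ilv e p) t)"

text \<open>Number parameters occupy the odd indices, so that they survive the pushing of bound variables.\<close>

definition dfn :: "((nat \<Rightarrow> 'a) \<Rightarrow> bool) \<Rightarrow> bool" where
  "dfn P \<longleftrightarrow> (\<exists>\<phi> E p. set_env M E \<and> (\<forall>e. P e \<longleftrightarrow> sat M (ilv e p) E \<phi>))"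

lemma tmfI: "(\<And>e. f e = eval M (ilv e p) t) \<Longrightarrow> tmf f"
  unfolding tmf_def by blast

lemma dfnI: "set_env M E \<Longrightarrow> (\<And>e. P e \<longleftrightarrow> sat M (ilv e p) E \<phi>) \<Longrightarrow> dfn P"
  unfolding dfn_def by blast

lemma tmf_proj: "tmf (\<lambda>e. e i)"
  unfolding tmf_def by (rule exI[of _ "Var (2 * i)"]) simp

lemma tmf_const: "tmf (\<lambda>e. c)"
  unfolding tmf_def by (rule exI[of _ "Var (Suc (2 * 0))"], rule exI[of _ "\<lambda>_. c"]) (simp add: ilv_def)

lemma tmf_merge:
  assumes "tmf f" "tmf g"
  obtains t u p where "\<And>e. f e = eval M (ilv e p) t" "\<And>e. g e = eval M (ilv e p) u"
proof -
  obtain t p where f: "\<And>e. f e = eval M (ilv e p) t" using assms(1) by (auto simp: tmf_def)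
  obtain u q where g: "\<And>e. g e = eval M (ilv e q) u" using assms(2) by (auto simp: tmf_def)
  show thesis
    by (rule that[of "ilv p q" "ren_tm (\<lambda>i. if even i then i else 2 * i - 1) t"
          "ren_tm (\<lambda>i. if even i then i else 2 * i + 1) u"])
       (simp_all only: eval_ren ilv_left ilv_right f g)
qed

lemma tmf_add: "tmf f \<Longrightarrow> tmf g \<Longrightarrow> tmf (\<lambda>e. f e \<oplus> g e)"
  by (erule (1) tmf_merge) (rule tmfI[where t = "Add _ _"], simp only: eval.simps)

lemma tmf_mul: "tmf f \<Longrightarrow> tmf g \<Longrightarrow> tmf (\<lambda>e. f e \<otimes> g e)"
  by (erule (1) tmf_merge) (rule tmfI[where t = "Mul _ _"], simp only: eval.simps)

lemma set_env_ex: "\<exists>E. set_env M E"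
  using rca by (auto simp: RCA0_star_def set_env_def)

lemma dfn_eq0: "tmf f \<Longrightarrow> tmf g \<Longrightarrow> dfn (\<lambda>e. f e = g e)"
  using set_env_ex by - (erule (1) tmf_merge, erule exE, erule dfnI[where \<phi> = "Eq _ _"], simp only: sat.simps)

lemma dfn_less0: "tmf f \<Longrightarrow> tmf g \<Longrightarrow> dfn (\<lambda>e. f e \<prec> g e)"
  using set_env_ex by - (erule (1) tmf_merge, erule exE, erule dfnI[where \<phi> = "Less _ _"], simp only: sat.simps)

lemma dfn_mem0:
  assumes "tmf f" "X \<in> setsM M"
  shows "dfn (\<lambda>e. f e \<in> X)"
proof -
  obtain t p where f: "\<And>e. f e = eval M (ilv e p) t" using assms(1) by (auto simp: tmf_def)
  show ?thesis unfolding dfn_def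
    by (rule exI[of _ "Mem t 0"], rule exI[of _ "\<lambda>_. X"], rule exI[of _ p])
       (simp add: f assms(2) set_env_def)
qed

lemma dfn_merge:
  assumes "dfn P" "dfn Q"
  obtains \<phi> \<psi> E p where "set_env M E" "\<And>e. P e \<longleftrightarrow> sat M (ilv e p) E \<phi>"
    "\<And>e. Q e \<longleftrightarrow> sat M (ilv e p) E \<psi>"
proof -
  obtain \<phi> E p where f: "set_env M E" "\<And>e. P e = sat M (ilv e p) E \<phi>"
    using assms(1) by (auto simp: dfn_def)
  obtain \<psi> F q where g: "set_env M F" "\<And>e. Q e = sat M (ilv e q) F \<psi>"
    using assms(2) by (auto simp: dfn_def)
  have "set_env M (ilv E F)" using f(1) g(1) by (auto simp: set_env_def ilv_def)
  then show thesis
  proof (rule that)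
    let ?\<phi> = "ren (\<lambda>i. if even i then i else 2 * i - 1) (\<lambda>j. 2 * j) \<phi>"
    let ?\<psi> = "ren (\<lambda>i. if even i then i else 2 * i + 1) (\<lambda>j. Suc (2 * j)) \<psi>"
    show "P e = sat M (ilv e (ilv p q)) (ilv E F) ?\<phi>"
      and "Q e = sat M (ilv e (ilv p q)) (ilv E F) ?\<psi>" for e
      by (simp_all only: sat_ren ilv_left ilv_right f g ilv_even ilv_odd)
  qed
qed

lemma dfn_neg:
  assumes "dfn P"
  shows "dfn (\<lambda>e. \<not> P e)"
proof -
  obtain \<phi> E p where "set_env M E" "\<And>e. P e = sat M (ilv e p) E \<phi>"
    using assms by (auto simp: dfn_def)
  then show ?thesis by (intro dfnI[of E _ p "Neg \<phi>"]) simp_all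
qed

lemma dfn_conj: "dfn P \<Longrightarrow> dfn Q \<Longrightarrow> dfn (\<lambda>e. P e \<and> Q e)"
  by (erule (1) dfn_merge) (erule dfnI[where \<phi> = "Conj _ _"], simp only: sat.simps)

lemma dfn_disj: "dfn P \<Longrightarrow> dfn Q \<Longrightarrow> dfn (\<lambda>e. P e \<or> Q e)"
  by (erule (1) dfn_merge) (erule dfnI[where \<phi> = "Disj _ _"], simp only: sat.simps)

lemma dfn_imp: "dfn P \<Longrightarrow> dfn Q \<Longrightarrow> dfn (\<lambda>e. P e \<longrightarrow> Q e)"
  unfolding imp_conv_disj by (intro dfn_disj dfn_neg)

lemma dfn_iff: "dfn P \<Longrightarrow> dfn Q \<Longrightarrow> dfn (\<lambda>e. P e \<longleftrightarrow> Q e)"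
  unfolding iff_conv_conj_imp by (intro dfn_conj dfn_imp)

lemma dfn_True: "dfn (\<lambda>e. True)"
  using dfn_eq0[OF tmf_const tmf_const, of \<zero> \<zero>] by simp

lemma dfn_bool: "dfn (\<lambda>e. b)"
  using dfn_True dfn_neg[OF dfn_True] by (cases b) auto

lemma dfn_rename:
  assumes "dfn P"
  shows "dfn (\<lambda>e. P (\<lambda>i. e (r i)))"
proof -
  obtain \<phi> E p where f: "set_env M E" "\<And>e. P e = sat M (ilv e p) E \<phi>"
    using assms(1) by (auto simp: dfn_def)
  have "(\<lambda>i. ilv e p (if even i then 2 * r (i div 2) else i)) = ilv (\<lambda>i. e (r i)) p" for e
    by (rule ext) (auto simp: ilv_def)
  then have "P (\<lambda>i. e (r i)) = sat M (ilv e p) E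
      (ren (\<lambda>i. if even i then 2 * r (i div 2) else i) (\<lambda>j. j) \<phi>)" for e
    by (simp only: sat_ren f)
  with f(1) show ?thesis unfolding dfn_def by blast
qed

text \<open>In this shape the premise for the matrix is computed by higher-order unification, and
  \<open>intro\<close> with the closure rules proves definability of predicates written in ordinary notation.\<close>

lemma dfn_bex0:
  assumes "tmf t" "dfn (\<lambda>e. R (e 0) (\<lambda>i. e (Suc i)))"
  shows "dfn (\<lambda>e. \<exists>x. x \<prec> t e \<and> R x e)"
proof -
  obtain \<phi> E p where
    E: "set_env M E" and P: "\<And>e. R (e 0) (\<lambda>i. e (Suc i)) = sat M (ilv e p) E \<phi>"
    using assms(2) by (auto simp: dfn_def)
  obtain u q where t: "\<And>e. t e = eval M (ilv e q) u" using assms(1) by (auto simp: tmf_def)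
  let ?s = "\<lambda>i. if i = 0 then 0 else if even i then i - 1 else Suc i"
  let ?l = "\<lambda>i. if even i then i else 2 * i - 1"
  let ?r = "\<lambda>i. if even i then i else 2 * i + 1"
  \<comment> \<open>The bound is evaluated outside the quantifier, so only the matrix needs the
    parity repair \<open>?s\<close>.\<close>
  define \<psi> where "\<psi> = BEx (ren_tm ?r u) (ren ?s id (ren ?l id \<phi>))"
  have "R x e = sat M (ilv (x \<triangleright> e) p) E \<phi>" for x e using P[of "x \<triangleright> e"] by simp
  then have "(\<exists>x. x \<prec> t e \<and> R x e) = sat M (ilv e (ilv p q)) E \<psi>" for e
    by (simp only: \<psi>_def sat.simps sat_ren eval_ren ilv_push ilv_left ilv_right t id_apply)
  with E show ?thesis unfolding dfn_def by blast
qed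

lemma dfn_ball0:
  assumes "tmf t" "dfn (\<lambda>e. R (e 0) (\<lambda>i. e (Suc i)))"
  shows "dfn (\<lambda>e. \<forall>x. x \<prec> t e \<longrightarrow> R x e)"
  using dfn_neg[OF dfn_bex0[where R = "\<lambda>x e. \<not> R x e", OF assms(1) dfn_neg[OF assms(2)]]]
  by simp

lemmas dfn0 = dfn_eq0 dfn_less0 dfn_conj dfn_disj dfn_imp dfn_iff dfn_neg dfn_bex0 dfn_ball0
  tmf_proj tmf_const tmf_add tmf_mul

text \<open>The bridge from \<open>dfn\<close> to the axioms. Two predicates are treated together
  because Delta1 comprehension evaluates both its formulas in the same environments.\<close>

lemma dfn2_normal_form:
  assumes "dfn (\<lambda>e. P (e 0) (e 1))" "dfn (\<lambda>e. Q (e 0) (e 1))"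
  obtains \<phi> \<psi> E p where "set_env M E" "\<And>z x. sat M (z \<triangleright> x \<triangleright> p) E \<phi> \<longleftrightarrow> P z x"
    "\<And>z x. sat M (z \<triangleright> x \<triangleright> p) E \<psi> \<longleftrightarrow> Q z x"
proof -
  obtain \<phi> \<psi> E p where *: "set_env M E" "\<And>e. P (e 0) (e 1) \<longleftrightarrow> sat M (ilv e p) E \<phi>"
    "\<And>e. Q (e 0) (e 1) \<longleftrightarrow> sat M (ilv e p) E \<psi>"
    using assms by (rule dfn_merge) (rule that)
  let ?r = "\<lambda>i::nat. if i = 0 then 0 else if i = 2 then 1 else if even i then 2 else i div 2 + 3"
  show thesis
  proof (rule that[OF *(1)])
    show "sat M (z \<triangleright> x \<triangleright> (\<zero> \<triangleright> p)) E (ren ?r id \<phi>) \<longleftrightarrow> P z x"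
      and "sat M (z \<triangleright> x \<triangleright> (\<zero> \<triangleright> p)) E (ren ?r id \<psi>) \<longleftrightarrow> Q z x" for z x
      using *(2,3)[of "z \<triangleright> x \<triangleright> (\<lambda>_. \<zero>)", symmetric] by (simp_all only: sat_ren ilv_params id_apply) simp_all
  qed
qed

lemma induct_dfn:
  assumes "dfn (\<lambda>e. P (e 0))" "P \<zero>" "\<And>x. P x \<Longrightarrow> P (x \<oplus> \<one>)"
  shows "P x"
proof -
  obtain \<phi> E p where *: "set_env M E" "\<And>z x. sat M (z \<triangleright> x \<triangleright> p) E \<phi> \<longleftrightarrow> P z"
    using dfn2_normal_form[of "\<lambda>z x. P z" "\<lambda>z x. P z"] assms(1) by metis
  have "Delta0_induction M" using rca by (simp add: RCA0_star_def)
  then have "sat M (\<zero> \<triangleright> \<zero> \<triangleright> p) E \<phi> \<longrightarrow>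
      (\<forall>x. sat M (x \<triangleright> \<zero> \<triangleright> p) E \<phi> \<longrightarrow> sat M (x \<oplus> \<one> \<triangleright> \<zero> \<triangleright> p) E \<phi>) \<longrightarrow>
      (\<forall>x. sat M (x \<triangleright> \<zero> \<triangleright> p) E \<phi>)"
    unfolding Delta0_induction_def using *(1) by blast
  then show ?thesis unfolding *(2) using assms(2,3) by blast
qed

lemma collection:
  assumes "dfn (\<lambda>e. R (e 0) (e 1))" "\<And>x. x \<prec> a \<Longrightarrow> \<exists>y. R y x"
  obtains b where "\<And>x. x \<prec> a \<Longrightarrow> \<exists>y. y \<prec> b \<and> R y x"
proof -
  obtain \<phi> E p where *: "set_env M E" "\<And>z x. sat M (z \<triangleright> x \<triangleright> p) E \<phi> \<longleftrightarrow> R z x"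
    using dfn2_normal_form[OF assms(1,1)] by metis
  \<comment> \<open>Shifting every variable makes the unbounded quantifier of the Sigma1 formula
    vacuous.\<close>
  have s: "sat_Sigma1 M (y \<triangleright> x \<triangleright> p) E (ren Suc id \<phi>) \<longleftrightarrow> R y x" for y x
    by (simp add: sat_Sigma1_def sat_ren *(2))
  have "Sigma1_collection M" using rca by (simp add: RCA0_star_def)
  then have "(\<forall>x. x \<prec> a \<longrightarrow> (\<exists>y. R y x)) \<longrightarrow> (\<exists>b. \<forall>x. x \<prec> a \<longrightarrow> (\<exists>y. y \<prec> b \<and> R y x))"
    unfolding Sigma1_collection_def s[symmetric] using *(1) by blast
  with assms(2) that show thesis by blast
qed

lemma comprehension_Delta1:
  assumes "dfn (\<lambda>e. P (e 0) (e 1))" "dfn (\<lambda>e. Q (e 0) (e 1))"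
    "\<And>x. (\<exists>z. P z x) \<longleftrightarrow> (\<forall>z. Q z x)"
  shows "{x. \<exists>z. P z x} \<in> setsM M"
proof -
  obtain \<phi> \<psi> E p where *: "set_env M E" "\<And>z x. sat M (z \<triangleright> x \<triangleright> p) E \<phi> \<longleftrightarrow> P z x"
    "\<And>z x. sat M (z \<triangleright> x \<triangleright> p) E \<psi> \<longleftrightarrow> Q z x"
    using assms(1,2) by (rule dfn2_normal_form) (rule that)
  have s: "sat_Sigma1 M (x \<triangleright> p) E \<phi> \<longleftrightarrow> (\<exists>z. P z x)" "sat_Pi1 M (x \<triangleright> p) E \<psi> \<longleftrightarrow> (\<forall>z. Q z x)" for x
    by (simp_all add: sat_Sigma1_def sat_Pi1_def *(2,3))
  have "Delta1_comprehension M" using rca by (simp add: RCA0_star_def)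
  then show ?thesis
    using *(1) assms(3) unfolding Delta1_comprehension_def s[symmetric] by blast
qed

lemma comprehension: "dfn (\<lambda>e. P (e 0)) \<Longrightarrow> {x. P x} \<in> setsM M"
  using comprehension_Delta1[of "\<lambda>z x. P x" "\<lambda>z x. P x"] dfn_rename[of "\<lambda>e. P (e 0)" "\<lambda>_. 1"] by simp

section \<open>Arithmetic\<close>

lemma basic:
  shows suc_neq: "x \<oplus> \<one> \<noteq> \<zero>"
    and add_0: "x \<oplus> \<zero> = x"
    and add_suc: "x \<oplus> (y \<oplus> \<one>) = (x \<oplus> y) \<oplus> \<one>"
    and mul_0: "x \<otimes> \<zero> = \<zero>"
    and mul_suc: "x \<otimes> (y \<oplus> \<one>) = x \<otimes> y \<oplus> x"
    and not_less_0: "\<not> x \<prec> \<zero>"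
    and less_suc: "x \<prec> y \<oplus> \<one> \<longleftrightarrow> x \<prec> y \<or> x = y"
  using rca by (auto simp: RCA0_star_def basic_axioms_def)

section \<open>Semiring and order laws by Delta0 induction\<close>

lemma zero_add: "\<zero> \<oplus> x = x"
  by (rule induct_dfn[where x = x]) (intro dfn0 | simp add: basic)+

lemma add_assoc: "(x \<oplus> y) \<oplus> z = x \<oplus> (y \<oplus> z)"
  by (rule induct_dfn[where x = z]) (intro dfn0 | simp add: add_0 add_suc)+

lemma suc_add: "(x \<oplus> \<one>) \<oplus> y = (x \<oplus> y) \<oplus> \<one>"
  by (rule induct_dfn[where x = y]) (intro dfn0 | simp add: add_0 add_suc)+

lemma add_comm: "x \<oplus> y = y \<oplus> x"
  by (rule induct_dfn[where x = y]) (intro dfn0 | simp add: add_0 add_suc zero_add suc_add)+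

lemma add_lcomm: "x \<oplus> (y \<oplus> z) = y \<oplus> (x \<oplus> z)"
  by (metis add_assoc add_comm)

lemma zero_mul: "\<zero> \<otimes> x = \<zero>"
  by (rule induct_dfn[where x = x]) (intro dfn0 | simp add: mul_0 add_0 mul_suc)+

lemma suc_mul: "(x \<oplus> \<one>) \<otimes> y = x \<otimes> y \<oplus> y"
proof (rule induct_dfn[where x = y])
  fix y assume "(x \<oplus> \<one>) \<otimes> y = x \<otimes> y \<oplus> y"
  then show "(x \<oplus> \<one>) \<otimes> (y \<oplus> \<one>) = x \<otimes> (y \<oplus> \<one>) \<oplus> (y \<oplus> \<one>)"
    by (simp only: mul_suc add_assoc) (metis add_comm add_lcomm)
qed (intro dfn0 | simp add: mul_0 add_0)+

lemma mul_comm: "x \<otimes> y = y \<otimes> x"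
  by (rule induct_dfn[where x = y]) (intro dfn0 | simp add: mul_0 mul_suc zero_mul suc_mul)+

lemma distrib: "(x \<oplus> y) \<otimes> z = x \<otimes> z \<oplus> y \<otimes> z"
proof (rule induct_dfn[where x = z])
  fix z assume "(x \<oplus> y) \<otimes> z = x \<otimes> z \<oplus> y \<otimes> z"
  then show "(x \<oplus> y) \<otimes> (z \<oplus> \<one>) = x \<otimes> (z \<oplus> \<one>) \<oplus> y \<otimes> (z \<oplus> \<one>)"
    by (simp only: mul_suc add_assoc) (metis add_comm add_lcomm)
qed (intro dfn0 | simp add: mul_0 add_0)+

lemma distrib_left: "z \<otimes> (x \<oplus> y) = z \<otimes> x \<oplus> z \<otimes> y"
  by (simp add: distrib mul_comm[of z])

lemma mul_assoc: "(x \<otimes> y) \<otimes> z = x \<otimes> (y \<otimes> z)"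
proof (rule induct_dfn[where x = z])
  fix z assume "(x \<otimes> y) \<otimes> z = x \<otimes> (y \<otimes> z)"
  then show "(x \<otimes> y) \<otimes> (z \<oplus> \<one>) = x \<otimes> (y \<otimes> (z \<oplus> \<one>))"
    by (simp only: mul_suc) (metis distrib mul_comm)
qed (intro dfn0 | simp add: mul_0)+

lemma one_mul: "\<one> \<otimes> x = x"
  by (metis mul_suc mul_0 zero_add mul_comm)

lemma less_trans: "x \<prec> y \<Longrightarrow> y \<prec> z \<Longrightarrow> x \<prec> z"
proof -
  have "x \<prec> y \<longrightarrow> y \<prec> z \<longrightarrow> x \<prec> z"
    by (rule induct_dfn[where x = z]) (intro dfn0 | auto simp add: not_less_0 less_suc)+
  then show "x \<prec> y \<Longrightarrow> y \<prec> z \<Longrightarrow> x \<prec> z" by blast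
qed

lemma less_irrefl: "\<not> x \<prec> x"
  by (rule induct_dfn[where x = x])
     (intro dfn0 | simp add: not_less_0 | metis less_suc less_trans)+

lemma zero_le: "\<zero> \<prec> x \<or> \<zero> = x"
  by (rule induct_dfn[where x = x]) (intro dfn0 | auto simp add: less_suc)+

lemma suc_less_suc: "x \<prec> y \<Longrightarrow> x \<oplus> \<one> \<prec> y \<oplus> \<one>"
proof -
  have "x \<prec> y \<longrightarrow> x \<oplus> \<one> \<prec> y \<oplus> \<one>"
    by (rule induct_dfn[where x = y]) (intro dfn0 | auto simp add: not_less_0 less_suc)+
  then show "x \<prec> y \<Longrightarrow> x \<oplus> \<one> \<prec> y \<oplus> \<one>" by blast
qed

lemma pred: "y = \<zero> \<or> (\<exists>z. y = z \<oplus> \<one>)"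
proof -
  \<comment> \<open>Bounding the predecessor makes the induction formula Delta0; later inductions on
    existential statements add such bounds for the same reason.\<close>
  have "y = \<zero> \<or> (\<exists>z. z \<prec> y \<and> y = z \<oplus> \<one>)"
    using less_suc[of \<zero> \<zero>]
    by - (rule induct_dfn[where x = y], (intro dfn0 | auto simp add: less_suc zero_add)+)
  then show ?thesis by blast
qed

lemma less_total: "x \<prec> y \<or> x = y \<or> y \<prec> x"
proof (rule induct_dfn[where x = x])
  show "\<zero> \<prec> y \<or> \<zero> = y \<or> y \<prec> \<zero>" using zero_le by blast
  fix x assume "x \<prec> y \<or> x = y \<or> y \<prec> x"
  then show "x \<oplus> \<one> \<prec> y \<or> x \<oplus> \<one> = y \<or> y \<prec> x \<oplus> \<one>"
    using pred[of y] not_less_0 less_suc suc_less_suc by metis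
qed (intro dfn0)+

lemma less_diff:
  assumes "x \<prec> y"
  shows "\<exists>z. y = x \<oplus> z \<and> z \<noteq> \<zero>"
proof -
  have "x \<prec> y \<or> x = y \<longrightarrow> (\<exists>z. z \<prec> y \<oplus> \<one> \<and> y = x \<oplus> z)"
  proof (rule induct_dfn[where x = y])
    fix y assume IH: "x \<prec> y \<or> x = y \<longrightarrow> (\<exists>z. z \<prec> y \<oplus> \<one> \<and> y = x \<oplus> z)"
    show "x \<prec> y \<oplus> \<one> \<or> x = y \<oplus> \<one> \<longrightarrow> (\<exists>z. z \<prec> y \<oplus> \<one> \<oplus> \<one> \<and> y \<oplus> \<one> = x \<oplus> z)"
      using IH by (metis add_0 add_suc less_suc suc_less_suc zero_le suc_neq)
  next
    show "x \<prec> \<zero> \<or> x = \<zero> \<longrightarrow> (\<exists>z. z \<prec> \<zero> \<oplus> \<one> \<and> \<zero> = x \<oplus> z)"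
      by (metis add_0 less_suc not_less_0)
  qed (intro dfn0)
  with assms show ?thesis by (metis add_0 less_irrefl)
qed

lemma less_add: "x \<prec> y \<Longrightarrow> x \<oplus> z \<prec> y \<oplus> z"
proof -
  assume a: "x \<prec> y"
  show ?thesis
    by (rule induct_dfn[where x = z]) (intro dfn0 | simp add: a add_0 add_suc suc_less_suc)+
qed

lemma add_cancel: "x \<oplus> z = y \<oplus> z \<Longrightarrow> x = y"
  using less_total[of x y] less_add[of x y z] less_add[of y x z] less_irrefl by metis

definition leq (infix "\<preceq>" 50) where "x \<preceq> y \<longleftrightarrow> x \<prec> y \<or> x = y"

lemma leq_add: "y \<preceq> y \<oplus> z"
  using less_add[of \<zero> z y] zero_le[of z]
  by (auto simp: leq_def zero_add add_0 add_comm[of z])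

lemma less_mul:
  assumes "x \<prec> y" "\<zero> \<prec> z"
  shows "z \<otimes> x \<prec> z \<otimes> y"
proof -
  obtain u where u: "y = x \<oplus> u" "u \<noteq> \<zero>" using less_diff[OF assms(1)] by blast
  obtain w where w: "u = w \<oplus> \<one>" using pred[of u] u(2) by blast
  obtain v where v: "z = v \<oplus> \<one>" using pred[of z] assms(2) less_irrefl by blast
  have "y \<otimes> z = x \<otimes> z \<oplus> (w \<otimes> z \<oplus> z)" using u w by (simp only: distrib one_mul)
  also have "w \<otimes> z \<oplus> z = (w \<otimes> z \<oplus> v) \<oplus> \<one>" using v by (metis add_suc)
  finally have "x \<otimes> z \<prec> y \<otimes> z" using leq_add[of "x \<otimes> z" "w \<otimes> z \<oplus> v"]
    by (simp add: add_suc less_suc leq_def)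
  then show ?thesis by (simp add: mul_comm[of z])
qed

text \<open>Truncation at \<open>\<zero>\<close> is what makes \<open>sub_sub\<close> and
  \<open>mul_sub\<close> hold without side conditions, as the semiring class demands.\<close>

definition sub where "sub x y = (if y \<preceq> x then THE z. x = y \<oplus> z else \<zero>)"

lemma sub_eq: "sub (y \<oplus> z) y = z"
proof -
  have "y \<preceq> y \<oplus> z"
    by (rule leq_add)
  moreover have "(THE v. y \<oplus> z = y \<oplus> v) = z"
    by (rule the_equality) (auto simp: add_comm[of y] dest: add_cancel)
  ultimately show ?thesis by (simp add: sub_def)
qed

lemma leqE: "x \<preceq> y \<Longrightarrow> \<exists>z. y = x \<oplus> z"
  unfolding leq_def by (metis add_0 less_diff)

lemma sub_0: "x \<prec> y \<Longrightarrow> sub x y = \<zero>"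
  unfolding sub_def leq_def using less_irrefl less_trans by metis

lemma less_iff: "x \<prec> y \<longleftrightarrow> x \<preceq> y \<and> \<not> y \<preceq> x"
  unfolding leq_def using less_irrefl less_trans by blast

lemma leq_total: "x \<preceq> y \<or> y \<preceq> x"
  unfolding leq_def using less_total by blast

lemma leq_trans: "x \<preceq> y \<Longrightarrow> y \<preceq> z \<Longrightarrow> x \<preceq> z"
  unfolding leq_def using less_trans by blast

lemma add_leq: "x \<preceq> y \<Longrightarrow> z \<oplus> x \<preceq> z \<oplus> y"
  unfolding leq_def using less_add[of x y z] by (auto simp: add_comm[of z])

lemma sub_sub: "sub (sub a b) c = sub a (b \<oplus> c)"
proof -
  have zero: "sub \<zero> x = \<zero>" for x
    using sub_eq[of \<zero> \<zero>] sub_0[of \<zero> x] zero_le[of x] by (auto simp: add_0)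
  consider "a \<prec> b" | d where "a = b \<oplus> d" "d \<prec> c" | d where "a = b \<oplus> (c \<oplus> d)"
    using leqE[of b a] leqE[of c] less_total unfolding leq_def by blast
  then show ?thesis
  proof cases
    case 1
    then have "a \<prec> b \<oplus> c" using leq_add[of b c] less_trans by (auto simp: leq_def)
    with 1 show ?thesis by (simp add: sub_0 zero)
  next
    case (2 d)
    then have "a \<prec> b \<oplus> c" using less_add[of d c b] by (simp add: add_comm[of b])
    with 2 show ?thesis by (simp add: sub_0 sub_eq)
  next
    case (3 d)
    have "sub a b = c \<oplus> d" "sub a (b \<oplus> c) = d"
      using 3 sub_eq[of b "c \<oplus> d"] sub_eq[of "b \<oplus> c" d] by (simp_all add: add_assoc)
    then show ?thesis by (simp only: sub_eq)
  qed
qed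

lemma mul_sub: "a \<otimes> sub b c = sub (a \<otimes> b) (a \<otimes> c)"
proof -
  have zero: "sub \<zero> \<zero> = \<zero>" using sub_eq[of \<zero> \<zero>] by (simp add: add_0)
  consider d where "b = c \<oplus> d" | "b \<prec> c" "a = \<zero>" | "b \<prec> c" "\<zero> \<prec> a"
    using leqE[of c b] less_total[of b c] zero_le[of a] by (auto simp: leq_def)
  then show ?thesis
  proof cases
    case (1 d)
    then have "a \<otimes> b = a \<otimes> c \<oplus> a \<otimes> d" by (simp only: distrib_left)
    with 1 show ?thesis by (simp only: sub_eq)
  qed (simp_all add: zero zero_mul mul_0 sub_0 less_mul)
qed

lemma zero_neq_one: "\<zero> \<noteq> \<one>"
  using suc_neq[of \<zero>] by (simp add: zero_add)

lemma no_zero_div: "a \<noteq> \<zero> \<Longrightarrow> b \<noteq> \<zero> \<Longrightarrow> a \<otimes> b \<noteq> \<zero>"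
  using zero_le[of a] zero_le[of b] less_mul[of \<zero> b a] less_irrefl by (auto simp: mul_0)

lemma leq_refl: "x \<preceq> x"
  by (simp add: leq_def)

lemma leq_antisym: "x \<preceq> y \<Longrightarrow> y \<preceq> x \<Longrightarrow> x = y"
  unfolding leq_def using less_trans less_irrefl by blast

lemma zero_less_one: "\<zero> \<prec> \<one>"
  using zero_le[of \<one>] zero_neq_one by blast

lemma sub_add: "y \<preceq> x \<Longrightarrow> sub x y \<oplus> y = x"
proof -
  assume "y \<preceq> x"
  then obtain z where "x = y \<oplus> z" using leqE by blast
  then show ?thesis by (simp only: sub_eq add_comm)
qed

text \<open>Provides the simplification, monotonicity and calculational order rules of ordered
  semirings for \<open>M\<close>.\<close>

sublocale sr: linordered_semidom
  where minus = sub and one = \<one> and times = "(\<otimes>)" and zero = \<zero> and plus = "(\<oplus>)"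
    and less_eq = "(\<preceq>)" and less = "(\<prec>)"
  by unfold_locales
    (rule add_assoc mul_assoc add_comm mul_comm sub_eq sub_sub mul_sub less_iff leq_refl leq_total
      zero_neq_one zero_add zero_mul mul_0 one_mul distrib distrib_left zero_less_one
    | (rule leq_trans leq_antisym; assumption)
    | (erule add_leq less_mul; assumption?)
    | (rule no_zero_div, assumption, assumption)
    | (erule sub_add))+

(* This simp rule would turn the 2 of the coding definitions into a locale-relative numeral. *)
declare sr.one_add_one [simp del]

section \<open>Substitution of bounded functions into Delta0 predicates\<close>

lemma tmf_rename:
  assumes "tmf t"
  shows "tmf (\<lambda>e. t (\<lambda>i. e (r i)))"
proof -
  obtain u p where t: "\<And>e. t e = eval M (ilv e p) u" using assms by (auto simp: tmf_def)
  have "(\<lambda>i. ilv e p (if even i then 2 * r (i div 2) else i)) = ilv (\<lambda>i. e (r i)) p" for e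
    by (rule ext) (auto simp: ilv_def)
  then have "t (\<lambda>i. e (r i)) = eval M (ilv e p) (ren_tm (\<lambda>i. if even i then 2 * r (i div 2) else i) u)" for e
    by (simp only: eval_ren t)
  then show ?thesis by (rule tmfI)
qed

text \<open>A Delta0 graph alone does not suffice for substitution: the value has to be named by a
  quantifier, and the dominating term bounds that quantifier.\<close>

definition fn :: "((nat \<Rightarrow> 'a) \<Rightarrow> 'a) \<Rightarrow> bool" where
  "fn f \<longleftrightarrow> (\<exists>t. tmf t \<and> (\<forall>e. f e \<preceq> t e)) \<and> dfn (\<lambda>e. e 0 = f (\<lambda>i. e (Suc i)))"

lemma less_suc_leq: "x \<prec> y \<oplus> \<one> \<longleftrightarrow> x \<preceq> y"
  by (simp add: leq_def less_suc)

lemma fn_tmf: "tmf t \<Longrightarrow> fn t"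
  unfolding fn_def using leq_refl dfn_eq0[OF tmf_proj tmf_rename[of t Suc]] by blast

lemma fn_subst:
  assumes "fn f" "dfn (\<lambda>e. R (e 0) (\<lambda>i. e (Suc i)))"
  shows "dfn (\<lambda>e. R (f e) e)"
proof -
  obtain t where t: "tmf t" "\<And>e. f e \<preceq> t e" using assms(1) by (auto simp: fn_def)
  have "dfn (\<lambda>e. \<exists>x. x \<prec> t e \<oplus> \<one> \<and> x = f e \<and> R x e)"
    using assms by (intro dfn_bex0 tmf_add t tmf_const dfn_conj) (simp_all add: fn_def)
  also have "(\<lambda>e. \<exists>x. x \<prec> t e \<oplus> \<one> \<and> x = f e \<and> R x e) = (\<lambda>e. R (f e) e)"
    using t(2) by (auto simp: less_suc_leq)
  finally show ?thesis .
qed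

lemma fn_rename:
  assumes "fn f"
  shows "fn (\<lambda>e. f (\<lambda>i. e (r i)))"
proof -
  obtain t where t: "tmf t" "\<And>e. f e \<preceq> t e" using assms(1) by (auto simp: fn_def)
  have "dfn (\<lambda>e. e 0 = f (\<lambda>i. e (Suc (r i))))"
    using dfn_rename[of "\<lambda>e. e 0 = f (\<lambda>i. e (Suc i))" "case_nat 0 (\<lambda>i. Suc (r i))"] assms
    by (simp add: fn_def)
  with t tmf_rename[OF t(1)] show ?thesis unfolding fn_def by blast
qed

lemma dfn_rel2:
  assumes "dfn (\<lambda>e. R (e 0) (e 1))" "fn f" "fn g"
  shows "dfn (\<lambda>e. R (f e) (g e))"
proof (rule fn_subst[OF assms(2), of "\<lambda>x e. R x (g e)"],
    rule fn_subst[OF fn_rename[OF assms(3)], of "\<lambda>y e. R (e 0) y"])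
  show "dfn (\<lambda>e. R (e (Suc 0)) (e 0))"
    using dfn_rename[OF assms(1), of "\<lambda>i. if i = 0 then 1 else 0"] by simp
qed

lemma dfn_rel3:
  assumes "dfn (\<lambda>e. R (e 0) (e 1) (e 2))" "fn f" "fn g" "fn h"
  shows "dfn (\<lambda>e. R (f e) (g e) (h e))"
proof (rule fn_subst[OF assms(2), of "\<lambda>x e. R x (g e) (h e)"],
    rule fn_subst[OF fn_rename[OF assms(3)], of "\<lambda>y e. R (e 0) y (h (\<lambda>i. e (Suc i)))"],
    rule fn_subst[OF fn_rename[OF assms(4)], of "\<lambda>z e. R (e (Suc 0)) (e 0) z"])
  show "dfn (\<lambda>e. R (e (Suc (Suc 0))) (e (Suc 0)) (e 0))"
    using dfn_rename[OF assms(1), of "\<lambda>i. 2 - i"] by (simp add: numeral_2_eq_2)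
qed

lemma dfn_rel1: "dfn (\<lambda>e. P (e 0)) \<Longrightarrow> fn f \<Longrightarrow> dfn (\<lambda>e. P (f e))"
  by (rule fn_subst[where R = "\<lambda>x e. P x"])

lemma dfn_eq: "fn f \<Longrightarrow> fn g \<Longrightarrow> dfn (\<lambda>e. f e = g e)"
  by (rule dfn_rel2[of "(=)"]) (intro dfn0)

lemma dfn_less: "fn f \<Longrightarrow> fn g \<Longrightarrow> dfn (\<lambda>e. f e \<prec> g e)"
  by (rule dfn_rel2[of "(\<prec>)"]) (intro dfn0)

lemma dfn_leq: "fn f \<Longrightarrow> fn g \<Longrightarrow> dfn (\<lambda>e. f e \<preceq> g e)"
  unfolding leq_def by (intro dfn_disj dfn_less dfn_eq)

lemma dfn_mem: "X \<in> setsM M \<Longrightarrow> fn f \<Longrightarrow> dfn (\<lambda>e. f e \<in> X)"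
  by (rule dfn_rel1[of "\<lambda>x. x \<in> X"]) (intro dfn_mem0 tmf_proj)

lemma dfn_bex:
  assumes "fn f" "dfn (\<lambda>e. R (e 0) (\<lambda>i. e (Suc i)))"
  shows "dfn (\<lambda>e. \<exists>x. x \<prec> f e \<and> R x e)"
proof (rule fn_subst[OF assms(1), of "\<lambda>y e. \<exists>x. x \<prec> y \<and> R x e"], rule dfn_bex0)
  show "dfn (\<lambda>e. R (e 0) (\<lambda>i. e (Suc (Suc i))))"
    using dfn_rename[OF assms(2), of "case_nat 0 (\<lambda>i. Suc (Suc i))"] by simp
qed (rule tmf_proj)

lemma dfn_ball:
  assumes "fn f" "dfn (\<lambda>e. R (e 0) (\<lambda>i. e (Suc i)))"
  shows "dfn (\<lambda>e. \<forall>x. x \<prec> f e \<longrightarrow> R x e)"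
  using dfn_neg[OF dfn_bex[where R = "\<lambda>x e. \<not> R x e", OF assms(1) dfn_neg[OF assms(2)]]]
  by simp

text \<open>The operation \<open>b\<close> on terms dominates \<open>h\<close> even at larger
  arguments, so bounds for the arguments combine to a bound for the value.\<close>

lemma fn_op2:
  assumes "fn f" "fn g" "dfn (\<lambda>e. e 0 = h (e 1) (e 2))"
    and "\<And>t u. tmf t \<Longrightarrow> tmf u \<Longrightarrow> tmf (\<lambda>e. b (t e) (u e))"
    and "\<And>x y x' y'. x \<preceq> x' \<Longrightarrow> y \<preceq> y' \<Longrightarrow> h x y \<preceq> b x' y'"
  shows "fn (\<lambda>e. h (f e) (g e))"
proof -
  obtain t where t: "tmf t" "\<And>e. f e \<preceq> t e" using assms(1) by (auto simp: fn_def)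
  obtain u where u: "tmf u" "\<And>e. g e \<preceq> u e" using assms(2) by (auto simp: fn_def)
  have "dfn (\<lambda>e. e 0 = h (f (\<lambda>i. e (Suc i))) (g (\<lambda>i. e (Suc i))))"
    by (rule dfn_rel3[of "\<lambda>z x y. z = h x y", OF assms(3) fn_tmf[OF tmf_proj]
          fn_rename[OF assms(1)] fn_rename[OF assms(2)]])
  moreover have "h (f e) (g e) \<preceq> b (t e) (u e)" for e using t(2) u(2) by (rule assms(5))
  ultimately show ?thesis unfolding fn_def using assms(4)[OF t(1) u(1)] by blast
qed

lemma fn_op1:
  assumes "dfn (\<lambda>e. e 0 = h (e 1))" "\<And>x. h x \<preceq> x" "fn f"
  shows "fn (\<lambda>e. h (f e))"
  by (rule fn_op2[OF assms(3,3), of "\<lambda>x y. h x" "\<lambda>x y. x"])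
     (use assms(1,2) leq_trans in \<open>simp_all, blast\<close>)

lemma fn_add: "fn f \<Longrightarrow> fn g \<Longrightarrow> fn (\<lambda>e. f e \<oplus> g e)"
  by (rule fn_op2[of f g "(\<oplus>)" "(\<oplus>)"], assumption+) (intro dfn0, intro dfn0, assumption+, rule sr.add_mono)

lemma zero_leq [simp]: "\<zero> \<preceq> x"
  using zero_le by (auto simp: leq_def)

lemma fn_mul: "fn f \<Longrightarrow> fn g \<Longrightarrow> fn (\<lambda>e. f e \<otimes> g e)"
  by (rule fn_op2[of f g "(\<otimes>)" "(\<otimes>)"], assumption+)
     (intro dfn0, intro dfn0, assumption+, rule sr.mult_mono, simp_all)

lemma fn_proj: "fn (\<lambda>e. e i)"
  by (rule fn_tmf) (rule tmf_proj)

lemma fn_const: "fn (\<lambda>e. c)"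
  by (rule fn_tmf) (rule tmf_const)

lemmas dfn_intros = dfn_eq dfn_less dfn_leq dfn_conj dfn_disj dfn_imp dfn_iff dfn_neg dfn_bex dfn_ball
  fn_proj fn_const fn_add fn_mul

section \<open>Division and the pairing function\<close>

lemma division:
  assumes "\<zero> \<prec> b"
  obtains q r where "a = q \<otimes> b \<oplus> r" "r \<prec> b"
proof -
  have "\<exists>q. q \<prec> a \<oplus> \<one> \<and> (\<exists>r. r \<prec> b \<and> a = q \<otimes> b \<oplus> r)"
  proof (rule induct_dfn[where x = a])
    fix a assume "\<exists>q. q \<prec> a \<oplus> \<one> \<and> (\<exists>r. r \<prec> b \<and> a = q \<otimes> b \<oplus> r)"
    then obtain q r where q: "q \<prec> a \<oplus> \<one>" "r \<prec> b" "a = q \<otimes> b \<oplus> r" by blast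
    show "\<exists>q. q \<prec> a \<oplus> \<one> \<oplus> \<one> \<and> (\<exists>r. r \<prec> b \<and> a \<oplus> \<one> = q \<otimes> b \<oplus> r)"
    proof (cases "r \<oplus> \<one> \<prec> b")
      case True
      with q show ?thesis by (intro exI[of _ q] exI[of _ "r \<oplus> \<one>"] conjI) (simp_all add: add_suc less_suc)
    next
      case False
      with q(2) have "r \<oplus> \<one> = b" using suc_less_suc[of r b] by (auto simp: less_suc)
      then have "a \<oplus> \<one> = (q \<oplus> \<one>) \<otimes> b \<oplus> \<zero>" using q(3) by (simp add: suc_mul add_assoc)
      with suc_less_suc[OF q(1)] assms show ?thesis
        by (intro exI[of _ "q \<oplus> \<one>"] exI[of _ \<zero>] conjI)
    qed
  next
    show "\<exists>q. q \<prec> \<zero> \<oplus> \<one> \<and> (\<exists>r. r \<prec> b \<and> \<zero> = q \<otimes> b \<oplus> r)"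
      using assms by (intro exI[of _ \<zero>]) (simp add: less_suc)
  qed (intro dfn_intros)
  then show thesis using that by blast
qed

lemma division_unique:
  assumes "q \<otimes> b \<oplus> r = q' \<otimes> b \<oplus> r'" "r \<prec> b" "r' \<prec> b"
  shows "q = q' \<and> r = r'"
proof -
  have *: "q \<otimes> b \<oplus> r \<prec> q' \<otimes> b \<oplus> r'" if "q \<prec> q'" "r \<prec> b" for q q' r r'
  proof -
    from less_diff[OF that(1)] obtain u where "q' = q \<oplus> u" "u \<noteq> \<zero>" by blast
    then obtain d where d: "q' = q \<oplus> (d \<oplus> \<one>)" using pred[of u] by blast
    have "q \<otimes> b \<oplus> r \<prec> q \<otimes> b \<oplus> b" using that(2) by simp
    also have "\<dots> \<preceq> q \<otimes> b \<oplus> b \<oplus> (d \<otimes> b \<oplus> r')" by (rule leq_add)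
    also have "\<dots> = q' \<otimes> b \<oplus> r'" by (simp add: d distrib add_assoc add_comm add_lcomm)
    finally show ?thesis .
  qed
  have "q = q'" using *[of q q' r r'] *[of q' q r' r] assms less_total[of q q'] less_irrefl by metis
  with assms(1) show ?thesis by simp
qed

abbreviation two where "two \<equiv> \<one> \<oplus> \<one>"

lemma two_pos: "\<zero> \<prec> two"
  by (simp add: less_suc_leq)

text \<open>Makes the halving in the Cantor pairing function exact.\<close>

lemma even_consecutive: "\<exists>t. two \<otimes> t = m \<otimes> (m \<oplus> \<one>)"
proof -
  have "\<exists>t. t \<prec> m \<otimes> (m \<oplus> \<one>) \<oplus> \<one> \<and> two \<otimes> t = m \<otimes> (m \<oplus> \<one>)"
  proof (rule induct_dfn[where x = m])
    fix m assume "\<exists>t. t \<prec> m \<otimes> (m \<oplus> \<one>) \<oplus> \<one> \<and> two \<otimes> t = m \<otimes> (m \<oplus> \<one>)"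
    then obtain t where t: "two \<otimes> t = m \<otimes> (m \<oplus> \<one>)" by blast
    have "two \<otimes> (t \<oplus> (m \<oplus> \<one>)) = m \<otimes> (m \<oplus> \<one>) \<oplus> two \<otimes> (m \<oplus> \<one>)"
      by (simp only: distrib_left t)
    also have "\<dots> = (m \<oplus> \<one>) \<otimes> (m \<oplus> \<one> \<oplus> \<one>)" by (simp add: algebra_simps)
    finally have "two \<otimes> (t \<oplus> (m \<oplus> \<one>)) = (m \<oplus> \<one>) \<otimes> (m \<oplus> \<one> \<oplus> \<one>)" .
    moreover from this have "t \<oplus> (m \<oplus> \<one>) \<preceq> (m \<oplus> \<one>) \<otimes> (m \<oplus> \<one> \<oplus> \<one>)"
      using leq_add[of "t \<oplus> (m \<oplus> \<one>)" "t \<oplus> (m \<oplus> \<one>)"] by (simp add: distrib)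
    ultimately show "\<exists>t. t \<prec> (m \<oplus> \<one>) \<otimes> (m \<oplus> \<one> \<oplus> \<one>) \<oplus> \<one> \<and> two \<otimes> t = (m \<oplus> \<one>) \<otimes> (m \<oplus> \<one> \<oplus> \<one>)"
      unfolding less_suc_leq by blast
  next
    show "\<exists>t. t \<prec> \<zero> \<otimes> (\<zero> \<oplus> \<one>) \<oplus> \<one> \<and> two \<otimes> t = \<zero> \<otimes> (\<zero> \<oplus> \<one>)"
      by (intro exI[of _ \<zero>]) (simp add: less_suc)
  qed (intro dfn_intros)
  then show ?thesis by blast
qed

lemma two_less_cancel: "two \<otimes> x \<prec> two \<otimes> y \<longleftrightarrow> x \<prec> y"
proof
  show "two \<otimes> x \<prec> two \<otimes> y" if "x \<prec> y" using that two_pos by (rule less_mul)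
  show "x \<prec> y" if *: "two \<otimes> x \<prec> two \<otimes> y"
  proof -
    have "\<not> y \<prec> x" using * less_mul[OF _ two_pos, of y x] less_trans less_irrefl by blast
    moreover have "y \<noteq> x" using * less_irrefl by blast
    ultimately show ?thesis using less_total by blast
  qed
qed

lemma two_leq_cancel: "two \<otimes> x \<preceq> two \<otimes> y \<longleftrightarrow> x \<preceq> y"
  using two_less_cancel[of y x] less_iff leq_total by blast

lemma two_cancel: "two \<otimes> x = two \<otimes> y \<longleftrightarrow> x = y"
  using two_leq_cancel leq_antisym leq_refl by metis

text \<open>Replaces the description operator by an equation between terms, so that the graph of
  pairing is Delta0.\<close>

lemma pair_iff:
  "z = pair M x y \<longleftrightarrow> two \<otimes> z = (x \<oplus> y) \<otimes> (x \<oplus> y \<oplus> \<one>) \<oplus> two \<otimes> y"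
proof -
  obtain t where t: "two \<otimes> t = (x \<oplus> y) \<otimes> (x \<oplus> y \<oplus> \<one>)" using even_consecutive by blast
  then have *: "two \<otimes> z = (x \<oplus> y) \<otimes> (x \<oplus> y \<oplus> \<one>) \<oplus> two \<otimes> y \<longleftrightarrow> z = t \<oplus> y" for z
    by (simp only: t[symmetric] distrib_left[symmetric] two_cancel)
  show ?thesis unfolding pair_def * by simp
qed

lemmas two_pair = pair_iff[THEN iffD1, OF refl]

lemma leq_add2: "y \<preceq> x \<oplus> y"
  using leq_add[of y x] by (simp only: add_comm)

text \<open>In doubled form, the triangular numbers of \<open>m\<close> and
  \<open>m \<oplus> \<one>\<close> differ by \<open>two \<otimes> (m \<oplus> \<one>)\<close>:
  enough room on the diagonal \<open>x \<oplus> y = m\<close> for the offset \<open>y\<close>, which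
  is at most \<open>m\<close>.\<close>

lemma mul_self_less:
  assumes "m \<prec> m'"
  shows "m \<otimes> (m \<oplus> \<one>) \<oplus> two \<otimes> (m \<oplus> \<one>) \<preceq> m' \<otimes> (m' \<oplus> \<one>)"
proof -
  have m: "m \<oplus> \<one> \<preceq> m'" using suc_less_suc[OF assms] unfolding less_suc_leq .
  have "m \<otimes> (m \<oplus> \<one>) \<oplus> two \<otimes> (m \<oplus> \<one>) = (m \<oplus> \<one>) \<otimes> (m \<oplus> \<one> \<oplus> \<one>)"
    by (simp add: algebra_simps)
  also have "\<dots> \<preceq> m' \<otimes> (m' \<oplus> \<one>)"
    by (rule sr.mult_mono[OF m sr.add_right_mono[OF m]]) simp_all
  finally show ?thesis .
qed

lemma pair_less:
  assumes "x \<oplus> y \<prec> x' \<oplus> y'"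
  shows "pair M x y \<prec> pair M x' y'"
proof -
  have "two \<otimes> (pair M x y) \<preceq> (x \<oplus> y) \<otimes> (x \<oplus> y \<oplus> \<one>) \<oplus> two \<otimes> (x \<oplus> y)"
    unfolding two_pair by (rule add_leq) (simp only: two_leq_cancel leq_add2)
  also have "\<dots> \<prec> (x \<oplus> y) \<otimes> (x \<oplus> y \<oplus> \<one>) \<oplus> two \<otimes> (x \<oplus> y \<oplus> \<one>)"
    by (rule sr.add_strict_left_mono) (simp only: two_less_cancel less_suc_leq leq_refl)
  also have "\<dots> \<preceq> (x' \<oplus> y') \<otimes> (x' \<oplus> y' \<oplus> \<one>)" using assms by (rule mul_self_less)
  also have "\<dots> \<preceq> two \<otimes> pair M x' y'" unfolding two_pair by (rule leq_add)
  finally show ?thesis unfolding two_less_cancel .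
qed

lemma pair_inject: "pair M x y = pair M x' y' \<longleftrightarrow> x = x' \<and> y = y'"
proof
  assume eq: "pair M x y = pair M x' y'"
  then have s: "x \<oplus> y = x' \<oplus> y'"
    using pair_less[of x y x' y'] pair_less[of x' y' x y] less_total[of "x \<oplus> y"] less_irrefl by metis
  then have "two \<otimes> y = two \<otimes> y'" using two_pair[of x y] two_pair[of x' y'] eq by simp
  then have "y = y'" by (simp only: two_cancel)
  with s show "x = x' \<and> y = y'" by simp
qed simp

lemma pair_geq: "x \<preceq> pair M x y" "y \<preceq> pair M x y"
proof -
  show "y \<preceq> pair M x y"
    unfolding two_leq_cancel[symmetric, of y] two_pair by (rule leq_add2)
  obtain t where t: "two \<otimes> t = (x \<oplus> y) \<otimes> (x \<oplus> y \<oplus> \<one>)" using even_consecutive by blast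
  have "x \<preceq> x \<oplus> y" by (rule leq_add)
  also have "x \<oplus> y \<preceq> t"
  proof (cases "x \<oplus> y = \<zero>")
    case False
    then obtain d where "x \<oplus> y = d \<oplus> \<one>" using pred[of "x \<oplus> y"] by blast
    then have "two \<otimes> t = two \<otimes> (x \<oplus> y) \<oplus> (x \<oplus> y) \<otimes> d" using t by (simp add: algebra_simps)
    then show ?thesis using leq_add two_leq_cancel by metis
  qed simp
  also have "t \<preceq> pair M x y"
    unfolding two_leq_cancel[symmetric, of t] two_pair t by (rule leq_add)
  finally show "x \<preceq> pair M x y" .
qed

lemma dfn_pair: "dfn (\<lambda>e. e 0 = pair M (e 1) (e 2))"
  unfolding pair_iff by (intro dfn0)

lemma fn_pair:
  assumes "fn f" "fn g"
  shows "fn (\<lambda>e. pair M (f e) (g e))"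
proof -
  let ?b = "\<lambda>x y. (x \<oplus> y) \<otimes> (x \<oplus> y \<oplus> \<one>) \<oplus> two \<otimes> y"
  show ?thesis
  proof (rule fn_op2[of f g "pair M" ?b, OF assms dfn_pair])
  show "tmf (\<lambda>e. ?b (t e) (u e))" if "tmf t" "tmf u" for t u using that by (intro dfn0)
  fix x y x' y' assume "x \<preceq> x'" "y \<preceq> y'"
  then have "?b x y \<preceq> ?b x' y'" by (intro sr.add_mono sr.mult_mono) simp_all
  moreover have "pair M x y \<preceq> two \<otimes> pair M x y" unfolding distrib one_mul by (rule leq_add)
  ultimately show "pair M x y \<preceq> ?b x' y'" unfolding two_pair using leq_trans by blast
  qed
qed

text \<open>The default \<open>\<zero>\<close> makes the projections total and bounded by their
  argument without appeal to surjectivity of pairing.\<close>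

definition p1 where "p1 z = (if \<exists>x y. z = pair M x y then THE x. \<exists>y. z = pair M x y else \<zero>)"
definition p2 where "p2 z = (if \<exists>x y. z = pair M x y then THE y. \<exists>x. z = pair M x y else \<zero>)"

lemma p1_pair [simp]: "p1 (pair M x y) = x" and p2_pair [simp]: "p2 (pair M x y) = y"
  unfolding p1_def p2_def by (auto simp: pair_inject)

lemma p1_leq: "p1 z \<preceq> z" and p2_leq: "p2 z \<preceq> z"
proof -
  have "p1 z \<preceq> z \<and> p2 z \<preceq> z"
  proof (cases "\<exists>x y. z = pair M x y")
    case True
    then show ?thesis using pair_geq by auto
  next
    case False
    then show ?thesis by (simp add: p1_def p2_def)
  qed
  then show "p1 z \<preceq> z" "p2 z \<preceq> z" by blast+
qed

lemma pair_ex_bounded: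
  "(\<exists>x y. z = pair M x y) \<longleftrightarrow> (\<exists>x. x \<prec> z \<oplus> \<one> \<and> (\<exists>y. y \<prec> z \<oplus> \<one> \<and> z = pair M x y))"
  unfolding less_suc_leq using pair_geq by blast

lemma fn_p1: "fn f \<Longrightarrow> fn (\<lambda>e. p1 (f e))"
proof (rule fn_op1[of p1, OF _ p1_leq])
  have "a = p1 z \<longleftrightarrow> (\<exists>y. y \<prec> z \<oplus> \<one> \<and> z = pair M a y) \<or> \<not> (\<exists>x. x \<prec> z \<oplus> \<one> \<and> (\<exists>y. y \<prec> z \<oplus> \<one> \<and> z = pair M x y)) \<and> a = \<zero>" for a z
  proof (cases "\<exists>x y. z = pair M x y")
    case True
    then obtain x y where z: "z = pair M x y" by blast
    then have "(\<exists>y. y \<prec> z \<oplus> \<one> \<and> z = pair M a y) \<longleftrightarrow> a = x"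
      unfolding less_suc_leq using pair_geq by (auto simp: pair_inject)
    with True show ?thesis unfolding pair_ex_bounded[symmetric] by (simp add: z)
  next
    case False
    then show ?thesis unfolding pair_ex_bounded[symmetric] by (auto simp: p1_def)
  qed
  then show "dfn (\<lambda>e. e 0 = p1 (e 1))" by (simp only:) (intro dfn_intros fn_pair)
qed

lemma fn_p2: "fn f \<Longrightarrow> fn (\<lambda>e. p2 (f e))"
proof (rule fn_op1[of p2, OF _ p2_leq])
  have "a = p2 z \<longleftrightarrow> (\<exists>x. x \<prec> z \<oplus> \<one> \<and> z = pair M x a) \<or> \<not> (\<exists>x. x \<prec> z \<oplus> \<one> \<and> (\<exists>y. y \<prec> z \<oplus> \<one> \<and> z = pair M x y)) \<and> a = \<zero>" for a z
  proof (cases "\<exists>x y. z = pair M x y")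
    case True
    then obtain x y where z: "z = pair M x y" by blast
    then have "(\<exists>x. x \<prec> z \<oplus> \<one> \<and> z = pair M x a) \<longleftrightarrow> a = y"
      unfolding less_suc_leq using pair_geq by (auto simp: pair_inject)
    with True show ?thesis unfolding pair_ex_bounded[symmetric] by (simp add: z)
  next
    case False
    then show ?thesis unfolding pair_ex_bounded[symmetric] by (auto simp: p2_def)
  qed
  then show "dfn (\<lambda>e. e 0 = p2 (e 1))" by (simp only:) (intro dfn_intros fn_pair)
qed

section \<open>Tuples\<close>

text \<open>Decodes any element into \<open>m\<close> entries. Whether it is a code of them is
  tested separately, by \<open>z = tuple M (utup m z)\<close>.\<close>

fun utup :: "nat \<Rightarrow> 'a \<Rightarrow> 'a list" where
  "utup 0 z = []"
| "utup (Suc 0) z = [z]"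
| "utup (Suc (Suc m)) z = p1 z # utup (Suc m) (p2 z)"

lemma length_utup [simp]: "length (utup m z) = m"
  by (induction m z rule: utup.induct) auto

lemma utup_tuple: "utup (length xs) (tuple M xs) = xs"
  by (induction xs rule: induct_list012) auto

lemma tuple_inject: "length xs = length ys \<Longrightarrow> tuple M xs = tuple M ys \<longleftrightarrow> xs = ys"
  by (metis utup_tuple)

text \<open>The list \<open>fs\<close> does not depend on the environment, so the length is one
  fixed standard number and a condition on all entries unfolds into a finite conjunction.\<close>

definition fnl :: "((nat \<Rightarrow> 'a) \<Rightarrow> 'a list) \<Rightarrow> bool" where
  "fnl F \<longleftrightarrow> (\<exists>fs. (\<forall>f\<in>set fs. fn f) \<and> F = (\<lambda>e. map (\<lambda>f. f e) fs))"

lemma fnlI: "(\<forall>f\<in>set fs. fn f) \<Longrightarrow> fnl (\<lambda>e. map (\<lambda>f. f e) fs)"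
  unfolding fnl_def by blast

lemma fnl_Nil: "fnl (\<lambda>e. [])"
  using fnlI[of "[]"] by simp

lemma fnl_Cons:
  assumes "fn f" "fnl F"
  shows "fnl (\<lambda>e. f e # F e)"
proof -
  obtain fs where "\<forall>f\<in>set fs. fn f" "F = (\<lambda>e. map (\<lambda>f. f e) fs)"
    using assms(2) unfolding fnl_def by blast
  then show ?thesis using assms(1) fnlI[of "f # fs"] by auto
qed

lemma fnl_append:
  assumes "fnl F" "fnl G"
  shows "fnl (\<lambda>e. F e @ G e)"
proof -
  obtain fs where "\<forall>f\<in>set fs. fn f" "F = (\<lambda>e. map (\<lambda>f. f e) fs)"
    using assms(1) unfolding fnl_def by blast
  moreover obtain gs where "\<forall>f\<in>set gs. fn f" "G = (\<lambda>e. map (\<lambda>f. f e) gs)"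
    using assms(2) unfolding fnl_def by blast
  ultimately show ?thesis using fnlI[of "fs @ gs"] by auto
qed

lemma fnl_butlast:
  assumes "fnl F"
  shows "fnl (\<lambda>e. butlast (F e))"
proof -
  obtain fs where "\<forall>f\<in>set fs. fn f" "F = (\<lambda>e. map (\<lambda>f. f e) fs)"
    using assms unfolding fnl_def by blast
  then show ?thesis using fnlI[of "butlast fs"] by (auto simp: map_butlast dest: in_set_butlastD)
qed

lemma fn_last:
  assumes "fnl F"
  shows "fn (\<lambda>e. last (F e))"
proof -
  obtain fs where "\<forall>f\<in>set fs. fn f" "F = (\<lambda>e. map (\<lambda>f. f e) fs)"
    using assms unfolding fnl_def by blast
  then show ?thesis by (cases "fs = []") (simp_all add: last_map fn_const)
qed

lemma fnl_map:
  assumes "\<And>f. fn f \<Longrightarrow> fn (\<lambda>e. h (f e))" "fnl F"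
  shows "fnl (\<lambda>e. map h (F e))"
proof -
  obtain fs where "\<forall>f\<in>set fs. fn f" "F = (\<lambda>e. map (\<lambda>f. f e) fs)"
    using assms(2) unfolding fnl_def by blast
  then show ?thesis using fnlI[of "map (\<lambda>f e. h (f e)) fs"] assms(1) by (auto simp: comp_def)
qed

lemma fnl_utup: "fn f \<Longrightarrow> fnl (\<lambda>e. utup m (f e))"
proof (induction m arbitrary: f)
  case (Suc m)
  show ?case
  proof (cases m)
    case 0
    then show ?thesis using fnl_Cons[OF Suc.prems fnl_Nil] by simp
  next
    case (Suc m')
    then show ?thesis using fnl_Cons[OF fn_p1[OF Suc.prems] Suc.IH[OF fn_p2[OF Suc.prems]]] by simp
  qed
qed (simp add: fnl_Nil)

lemma fn_tuple:
  assumes "fnl F"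
  shows "fn (\<lambda>e. tuple M (F e))"
proof -
  have "fn (\<lambda>e. tuple M (map (\<lambda>f. f e) fs))" if "\<forall>f\<in>set fs. fn f" for fs
    using that by (induction fs rule: induct_list012) (simp_all add: fn_const fn_pair)
  then show ?thesis using assms unfolding fnl_def by blast
qed

lemma dfn_sorted:
  assumes "fnl F"
  shows "dfn (\<lambda>e. sorted_wrt (\<prec>) (F e))"
proof -
  have all: "dfn (\<lambda>e. \<forall>y\<in>set (map (\<lambda>f. f e) fs). f e \<prec> y)"
    if "fn f" "\<forall>f\<in>set fs. fn f" for f fs
    using that(2)
  proof (induction fs)
    case (Cons g fs)
    then show ?case using dfn_conj[OF dfn_less[OF that(1), of g]] by simp
  qed (simp add: dfn_bool)
  have "dfn (\<lambda>e. sorted_wrt (\<prec>) (map (\<lambda>f. f e) fs))" if "\<forall>f\<in>set fs. fn f" for fs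
    using that
  proof (induction fs)
    case (Cons f fs)
    then show ?case using dfn_conj[OF all[of f fs]] by simp
  qed (simp add: dfn_bool)
  then show ?thesis using assms unfolding fnl_def by blast
qed

lemma dfn_list_all2:
  assumes "dfn (\<lambda>e. R (e 0) (e 1))" "fnl F" "fnl G"
  shows "dfn (\<lambda>e. list_all2 R (F e) (G e))"
proof -
  have "dfn (\<lambda>e. list_all2 R (map (\<lambda>f. f e) fs) (map (\<lambda>f. f e) gs))"
    if "\<forall>f\<in>set fs. fn f" "\<forall>f\<in>set gs. fn f" for fs gs
    using that
  proof (induction fs arbitrary: gs)
    case Nil
    then show ?case by (cases gs) (simp_all add: dfn_bool)
  next
    case (Cons f fs)
    then show ?case
    proof (cases gs)
      case (Cons g gs')
      then show ?thesis
        using dfn_conj[OF dfn_rel2[OF assms(1), of f g] Cons.IH[of gs']] Cons.prems by simp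
    qed (simp add: dfn_bool)
  qed
  then show ?thesis using assms(2,3) unfolding fnl_def by blast
qed

section \<open>Powers of two and binary digits\<close>

lemma beta_pos: "\<zero> \<prec> \<one> \<oplus> x"
  by (simp add: add_comm[of \<one>] less_suc_leq)

lemma leq_mul: "\<zero> \<prec> y \<Longrightarrow> x \<preceq> x \<otimes> y"
  using leq_add[of x] pred[of y] less_irrefl by (auto simp: mul_suc add_comm[of _ x])

text \<open>The modulus is positive, so the quotient is at most \<open>a\<close>; this makes
  \<open>beta\<close> Delta0.\<close>

lemma beta_iff:
  "beta M a b i r \<longleftrightarrow> (\<exists>q. q \<prec> a \<oplus> \<one> \<and> a = q \<otimes> (\<one> \<oplus> (i \<oplus> \<one>) \<otimes> b) \<oplus> r) \<and> r \<prec> \<one> \<oplus> (i \<oplus> \<one>) \<otimes> b"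
proof -
  have "q \<preceq> q \<otimes> (\<one> \<oplus> (i \<oplus> \<one>) \<otimes> b) \<oplus> r" for q
    using leq_mul[OF beta_pos] leq_add leq_trans by blast
  then show ?thesis unfolding beta_def less_suc_leq by blast
qed

lemma dfn_beta:
  assumes a: "fn a" and b: "fn b" and i: "fn i" and r: "fn r"
  shows "dfn (\<lambda>e. beta M (a e) (b e) (i e) (r e))"
  unfolding beta_iff
  by (intro dfn_intros a b i r fn_rename[OF a] fn_rename[OF b] fn_rename[OF i] fn_rename[OF r])

lemma beta_unique: "beta M a b i r \<Longrightarrow> beta M a b i r' \<Longrightarrow> r = r'"
  unfolding beta_def using division_unique by blast

lemma beta_leq: "beta M a b i r \<Longrightarrow> r \<preceq> a"
  unfolding beta_def using leq_add2 by blast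

text \<open>The Delta0 matrix of \<open>pow2\<close>: the code \<open>a\<close>, \<open>b\<close> of
  the sequence becomes an argument, and each entry \<open>r\<close>, being a remainder of
  \<open>a\<close>, is bounded by \<open>a\<close>.\<close>

definition doubling :: "'a \<Rightarrow> 'a \<Rightarrow> 'a \<Rightarrow> 'a \<Rightarrow> bool" where
  "doubling a b x y \<longleftrightarrow> beta M a b \<zero> \<one> \<and>
     (\<forall>i. i \<prec> x \<longrightarrow> (\<exists>r. r \<prec> a \<oplus> \<one> \<and> beta M a b i r \<and> beta M a b (i \<oplus> \<one>) (two \<otimes> r))) \<and> beta M a b x y"

lemma pow2_iff_doubling: "pow2 M x y \<longleftrightarrow> (\<exists>a b. doubling a b x y)"
  unfolding pow2_def doubling_def less_suc_leq using beta_leq by blast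

lemma dfn_doubling:
  assumes a: "fn a" and b: "fn b" and x: "fn x" and y: "fn y"
  shows "dfn (\<lambda>e. doubling (a e) (b e) (x e) (y e))"
  unfolding doubling_def
  by (intro dfn_intros dfn_beta a b x y fn_rename[OF a, of Suc] fn_rename[OF a, of "\<lambda>i. Suc (Suc i)"]
      fn_rename[OF b, of Suc] fn_rename[OF b, of "\<lambda>i. Suc (Suc i)"])

lemma doubling_start: "doubling a b x y \<Longrightarrow> beta M a b \<zero> \<one>"
  and doubling_end: "doubling a b x y \<Longrightarrow> beta M a b x y"
  by (simp_all add: doubling_def)

lemma doubling_step:
  assumes "doubling a b x y" "i \<prec> x" "beta M a b i r"
  shows "beta M a b (i \<oplus> \<one>) (two \<otimes> r)"
proof -
  obtain r' where "beta M a b i r'" "beta M a b (i \<oplus> \<one>) (two \<otimes> r')"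
    using assms(1,2) unfolding doubling_def by blast
  then show ?thesis using beta_unique[OF assms(3)] by blast
qed

text \<open>Two sequences that start with \<open>\<one>\<close> and double at each step agree entry
  by entry, though their codes may differ.\<close>

lemma pow2_unique:
  assumes "pow2 M x y" "pow2 M x y'"
  shows "y = y'"
proof -
  obtain a b where 1: "doubling a b x y" using assms(1) pow2_iff_doubling by blast
  obtain a' b' where 2: "doubling a' b' x y'" using assms(2) pow2_iff_doubling by blast
  have "i \<preceq> x \<longrightarrow> (\<exists>r. r \<prec> a \<oplus> \<one> \<and> beta M a b i r \<and> beta M a' b' i r)" for i
  proof (rule induct_dfn[where x = i])
    show "\<zero> \<preceq> x \<longrightarrow> (\<exists>r. r \<prec> a \<oplus> \<one> \<and> beta M a b \<zero> r \<and> beta M a' b' \<zero> r)"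
      using doubling_start[OF 1] doubling_start[OF 2] beta_leq[OF doubling_start[OF 1]]
      unfolding less_suc_leq by blast
    fix i assume IH: "i \<preceq> x \<longrightarrow> (\<exists>r. r \<prec> a \<oplus> \<one> \<and> beta M a b i r \<and> beta M a' b' i r)"
    show "i \<oplus> \<one> \<preceq> x \<longrightarrow> (\<exists>r. r \<prec> a \<oplus> \<one> \<and> beta M a b (i \<oplus> \<one>) r \<and> beta M a' b' (i \<oplus> \<one>) r)"
    proof
      assume "i \<oplus> \<one> \<preceq> x"
      then have i: "i \<prec> x" using sr.less_le_trans[of i "i \<oplus> \<one>" x] by (simp add: less_suc)
      then have "i \<preceq> x" by (simp add: leq_def)
      with IH obtain r where r: "beta M a b i r" "beta M a' b' i r" by blast
      have "beta M a b (i \<oplus> \<one>) (two \<otimes> r)" "beta M a' b' (i \<oplus> \<one>) (two \<otimes> r)"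
        using doubling_step[OF 1 i r(1)] doubling_step[OF 2 i r(2)] by blast+
      then show "\<exists>r. r \<prec> a \<oplus> \<one> \<and> beta M a b (i \<oplus> \<one>) r \<and> beta M a' b' (i \<oplus> \<one>) r"
        using beta_leq unfolding less_suc_leq by blast
    qed
  qed (intro dfn_intros dfn_beta)
  from this[of x] obtain r where "beta M a b x r" "beta M a' b' x r" using leq_refl by blast
  then have "y = r" "y' = r"
    using beta_unique[OF doubling_end[OF 1]] beta_unique[OF doubling_end[OF 2]] by blast+
  then show ?thesis by simp
qed

lemma pow2_total: "\<exists>y. pow2 M x y"
  using rca by (auto simp: RCA0_star_def exp_total_def)

definition two_pow :: "'a \<Rightarrow> 'a" where "two_pow x = (THE y. pow2 M x y)"

lemma pow2_iff: "pow2 M x y \<longleftrightarrow> y = two_pow x"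
  unfolding two_pow_def using pow2_total[of x] pow2_unique[of x] by (metis theI)

lemma two_pow_0: "two_pow \<zero> = \<one>"
proof -
  obtain a b where "doubling a b \<zero> (two_pow \<zero>)" using pow2_iff pow2_iff_doubling by blast
  then show ?thesis using beta_unique[OF doubling_end doubling_start] by blast
qed

lemma two_pow_suc: "two_pow (x \<oplus> \<one>) = two \<otimes> two_pow x"
proof -
  obtain a b where d: "doubling a b (x \<oplus> \<one>) (two_pow (x \<oplus> \<one>))" using pow2_iff pow2_iff_doubling by blast
  have x: "x \<prec> x \<oplus> \<one>" by (simp add: less_suc)
  with d obtain r where r: "beta M a b x r" unfolding doubling_def by blast
  \<comment> \<open>A sequence with one step more also serves for the exponent
    \<open>x\<close>.\<close>
  then have "doubling a b x r" using d unfolding doubling_def less_suc by blast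
  then have "r = two_pow x" using pow2_iff pow2_iff_doubling by blast
  then show ?thesis using beta_unique[OF doubling_end[OF d] doubling_step[OF d x r]] by simp
qed

text \<open>The defining formula of \<open>pow2\<close> is only \<open>\<Sigma>\<^sup>0\<^sub>1\<close>, but as the graph of a total function it is a
  set of the structure, hence available as a parameter.\<close>

lemma dfn_two_pow: "dfn (\<lambda>e. e 0 = two_pow (e 1))"
proof -
  let ?P = "\<lambda>w z. doubling (p1 w) (p2 w) (p1 z) (p2 z)"
  \<comment> \<open>The Pi1 form: every doubling sequence for the exponent \<open>p1 z\<close> ends
    in \<open>p2 z\<close>. Here \<open>w\<close> packs the two numbers coding the sequence and its
    last entry.\<close>
  let ?Q = "\<lambda>w z. doubling (p1 (p1 w)) (p2 (p1 w)) (p1 z) (p2 w) \<longrightarrow> p2 w = p2 z"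
  have P: "(\<exists>w. ?P w z) \<longleftrightarrow> p2 z = two_pow (p1 z)" for z
    using pow2_iff[of "p1 z"] pow2_iff_doubling[of "p1 z"] p1_pair p2_pair by metis
  have Q: "(\<forall>w. ?Q w z) \<longleftrightarrow> p2 z = two_pow (p1 z)" for z
    using pow2_iff[of "p1 z"] pow2_iff_doubling[of "p1 z"] p1_pair p2_pair by metis
  have "{z. \<exists>w. ?P w z} \<in> setsM M"
    by (rule comprehension_Delta1[of ?P ?Q])
       ((intro dfn_intros dfn_doubling fn_p1 fn_p2)+, simp only: P Q)
  then have "dfn (\<lambda>e. pair M (e 1) (e 0) \<in> {z. \<exists>w. ?P w z})"
    by (intro dfn_mem fn_pair fn_proj)
  then show ?thesis unfolding P by simp
qed

text \<open>Serves for \<open>two_pow\<close>, whose growth no term bounds, so that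
  \<open>fn_subst\<close> does not apply. For total \<open>h\<close> both "some value
  \<open>z\<close> of \<open>h\<close> satisfies \<open>P\<close>" and "every one does" express
  \<open>P x (h x)\<close>; Delta1 comprehension turns it into a set parameter.\<close>

lemma dfn_total_subst:
  assumes "dfn (\<lambda>e. P (e 0) (e 1))" "dfn (\<lambda>e. e 0 = h (e 1))"
  shows "dfn (\<lambda>e. P (e 0) (h (e 0)))"
proof -
  have P: "dfn (\<lambda>e. P (e 1) (e 0))" by (rule dfn_rel2[OF assms(1) fn_proj fn_proj])
  have "{x. \<exists>z. z = h x \<and> P x z} \<in> setsM M"
    by (rule comprehension_Delta1[of "\<lambda>z x. z = h x \<and> P x z" "\<lambda>z x. z = h x \<longrightarrow> P x z"])
       (intro dfn_conj dfn_imp P assms(2) | blast)+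
  from dfn_mem[OF this fn_proj, of 0] show ?thesis by simp
qed

lemma two_pow_pos: "\<zero> \<prec> two_pow x"
proof (rule induct_dfn[where x = x])
  show "dfn (\<lambda>e. \<zero> \<prec> two_pow (e 0))"
    by (rule dfn_total_subst[OF _ dfn_two_pow]) (intro dfn_intros)
qed (use two_pow_0 two_pow_suc leq_mul two_pos zero_less_one less_mul[of \<zero>] mul_0 in auto)

text \<open>The reason why adding a higher power of two leaves bit \<open>x\<close> alone.\<close>

lemma two_pow_dvd: "x \<prec> d \<Longrightarrow> \<exists>m. two_pow d = m \<otimes> (two \<otimes> two_pow x)"
proof -
  have "x \<prec> d \<longrightarrow> (\<exists>m. m \<prec> two_pow d \<oplus> \<one> \<and> two_pow d = m \<otimes> (two \<otimes> two_pow x))"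
  proof (rule induct_dfn[where x = d])
    show "dfn (\<lambda>e. x \<prec> e 0 \<longrightarrow> (\<exists>m. m \<prec> two_pow (e 0) \<oplus> \<one> \<and> two_pow (e 0) = m \<otimes> (two \<otimes> two_pow x)))"
      by (rule dfn_total_subst[OF _ dfn_two_pow]) (intro dfn_intros)
  next
    fix d assume IH: "x \<prec> d \<longrightarrow> (\<exists>m. m \<prec> two_pow d \<oplus> \<one> \<and> two_pow d = m \<otimes> (two \<otimes> two_pow x))"
    show "x \<prec> d \<oplus> \<one> \<longrightarrow> (\<exists>m. m \<prec> two_pow (d \<oplus> \<one>) \<oplus> \<one> \<and> two_pow (d \<oplus> \<one>) = m \<otimes> (two \<otimes> two_pow x))"
    proof
      assume "x \<prec> d \<oplus> \<one>"
      then consider "x \<prec> d" | "x = d" unfolding less_suc by blast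
      then obtain m where m: "two_pow (d \<oplus> \<one>) = m \<otimes> (two \<otimes> two_pow x)"
      proof cases
        case 1
        with IH obtain m where "two_pow d = m \<otimes> (two \<otimes> two_pow x)" by blast
        then have "two_pow (d \<oplus> \<one>) = (two \<otimes> m) \<otimes> (two \<otimes> two_pow x)" by (simp only: two_pow_suc mul_assoc)
        then show ?thesis by (rule that)
      next
        case 2
        then have "two_pow (d \<oplus> \<one>) = \<one> \<otimes> (two \<otimes> two_pow x)" by (simp only: two_pow_suc one_mul)
        then show ?thesis by (rule that)
      qed
      moreover have "m \<preceq> m \<otimes> (two \<otimes> two_pow x)"
        using less_mul[OF two_pow_pos two_pos] by (intro leq_mul) (simp only: mul_0)
      ultimately show "\<exists>m. m \<prec> two_pow (d \<oplus> \<one>) \<oplus> \<one> \<and> two_pow (d \<oplus> \<one>) = m \<otimes> (two \<otimes> two_pow x)"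
        unfolding less_suc_leq by metis
    qed
  qed (simp add: not_less_0)
  then show "x \<prec> d \<Longrightarrow> ?thesis" by blast
qed

section \<open>Binary digits and the coding of bounded sets\<close>

lemma Ack_iff: "x \<in> Ack M s \<longleftrightarrow> (\<exists>q r. r \<prec> two_pow x \<and> s = (two \<otimes> q \<oplus> \<one>) \<otimes> two_pow x \<oplus> r)"
  by (auto simp: Ack_def pow2_iff)

lemma dfn_Ack:
  assumes "fn f" "fn g"
  shows "dfn (\<lambda>e. f e \<in> Ack M (g e))"
proof (rule dfn_rel2[OF _ assms])
  \<comment> \<open>A power whose bit is set in \<open>s\<close> is at most \<open>s\<close>, which
    supplies the bound that \<open>two_pow\<close> itself lacks.\<close>
  have "x \<in> Ack M s \<longleftrightarrow> (\<exists>p. p \<prec> s \<oplus> \<one> \<and> p = two_pow x \<and> (\<exists>q. q \<prec> s \<oplus> \<one> \<and>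
      (\<exists>r. r \<prec> p \<and> s = (two \<otimes> q \<oplus> \<one>) \<otimes> p \<oplus> r)))" for x s
  proof -
    have "two_pow x \<preceq> s \<and> q \<preceq> s" if "s = (two \<otimes> q \<oplus> \<one>) \<otimes> two_pow x \<oplus> r" for q r
    proof -
      have "s = two_pow x \<oplus> (q \<otimes> two_pow x \<oplus> q \<otimes> two_pow x \<oplus> r)" "s = q \<otimes> two_pow x \<oplus> (q \<otimes> two_pow x \<oplus> two_pow x \<oplus> r)"
        using that by (simp_all add: algebra_simps)
      then show ?thesis using leq_add leq_mul[OF two_pow_pos] leq_trans by metis
    qed
    then show ?thesis unfolding Ack_iff less_suc_leq by blast
  qed
  moreover have "dfn (\<lambda>e. \<exists>p. p \<prec> e 1 \<oplus> \<one> \<and> p = two_pow (e 0) \<and> (\<exists>q. q \<prec> e 1 \<oplus> \<one> \<and>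
      (\<exists>r. r \<prec> p \<and> e 1 = (two \<otimes> q \<oplus> \<one>) \<otimes> p \<oplus> r)))"
    by (intro dfn_intros dfn_rel2[OF dfn_two_pow])
  ultimately show "dfn (\<lambda>e. e 0 \<in> Ack M (e 1))" by simp
qed

text \<open>Reduces bit \<open>x\<close> to a remainder modulo
  \<open>two \<otimes> two_pow x\<close>, where uniqueness of division applies.\<close>

lemma Ack_division:
  assumes "s = q \<otimes> (two \<otimes> two_pow x) \<oplus> t" "t \<prec> two \<otimes> two_pow x"
  shows "x \<in> Ack M s \<longleftrightarrow> two_pow x \<preceq> t"
proof
  assume "x \<in> Ack M s"
  then obtain q' r where r: "r \<prec> two_pow x" "s = (two \<otimes> q' \<oplus> \<one>) \<otimes> two_pow x \<oplus> r" unfolding Ack_iff by blast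
  then have "q' \<otimes> (two \<otimes> two_pow x) \<oplus> (two_pow x \<oplus> r) = q \<otimes> (two \<otimes> two_pow x) \<oplus> t"
    using assms(1) by (simp add: algebra_simps)
  moreover have "two_pow x \<oplus> r \<prec> two \<otimes> two_pow x"
    unfolding distrib one_mul using r(1) by (rule sr.add_strict_left_mono)
  ultimately have "t = two_pow x \<oplus> r" using division_unique assms(2) by blast
  then show "two_pow x \<preceq> t" by (simp only: leq_add)
next
  assume "two_pow x \<preceq> t"
  then obtain r where r: "t = two_pow x \<oplus> r" using leqE by blast
  have "two_pow x \<oplus> r \<prec> two_pow x \<oplus> two_pow x" using assms(2) unfolding r distrib one_mul .
  then have "r \<prec> two_pow x" by (rule sr.add_less_imp_less_left)
  moreover have "s = (two \<otimes> q \<oplus> \<one>) \<otimes> two_pow x \<oplus> r" using assms(1) r by (simp add: algebra_simps)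
  ultimately show "x \<in> Ack M s" unfolding Ack_iff by blast
qed

lemma Ack_add_two_pow:
  assumes "x \<prec> d"
  shows "x \<in> Ack M (s \<oplus> two_pow d) \<longleftrightarrow> x \<in> Ack M s"
proof -
  obtain m where m: "two_pow d = m \<otimes> (two \<otimes> two_pow x)" using two_pow_dvd[OF assms] by blast
  have "\<zero> \<prec> two \<otimes> two_pow x" using less_mul[OF two_pow_pos two_pos] by (simp only: mul_0)
  then obtain q t where t: "s = q \<otimes> (two \<otimes> two_pow x) \<oplus> t" "t \<prec> two \<otimes> two_pow x" by (rule division)
  then have "s \<oplus> two_pow d = (q \<oplus> m) \<otimes> (two \<otimes> two_pow x) \<oplus> t" unfolding m by (simp add: algebra_simps)
  with t show ?thesis using Ack_division by blast
qed

lemma Ack_top: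
  assumes "s \<prec> two_pow d"
  shows "d \<in> Ack M (s \<oplus> two_pow d)" "d \<notin> Ack M s"
proof -
  have *: "s \<oplus> two_pow d \<prec> two \<otimes> two_pow d" unfolding distrib one_mul using assms by (rule less_add)
  have "s \<oplus> two_pow d = \<zero> \<otimes> (two \<otimes> two_pow d) \<oplus> (s \<oplus> two_pow d)" by (simp only: zero_mul zero_add)
  then show "d \<in> Ack M (s \<oplus> two_pow d)" using Ack_division[OF _ *] leq_add2 by blast
  have "s \<prec> two \<otimes> two_pow d" by (rule sr.le_less_trans[OF leq_add *])
  moreover have "s = \<zero> \<otimes> (two \<otimes> two_pow d) \<oplus> s" by (simp only: zero_mul zero_add)
  ultimately show "d \<notin> Ack M s" using Ack_division assms less_iff by blast
qed

text \<open>Induction on \<open>d\<close>, adding \<open>two_pow d\<close> to the code exactly if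
  \<open>P d\<close> holds. The bound on \<open>s\<close> makes the induction formula definable and
  leaves bit \<open>d\<close> clear before the addition; it also confines the candidates in
  \<open>Chong_Mourad\<close>.\<close>

lemma coded_bounded:
  assumes "dfn (\<lambda>e. P (e 0))"
  shows "\<exists>s. s \<prec> two_pow d \<and> (\<forall>x. x \<prec> d \<longrightarrow> (x \<in> Ack M s \<longleftrightarrow> P x))"
proof (rule induct_dfn[where x = d])
  show "dfn (\<lambda>e. \<exists>s. s \<prec> two_pow (e 0) \<and> (\<forall>x. x \<prec> e 0 \<longrightarrow> (x \<in> Ack M s \<longleftrightarrow> P x)))"
    by (rule dfn_total_subst[OF _ dfn_two_pow]) (intro dfn_intros dfn_Ack dfn_rel1[OF assms])
  show "\<exists>s. s \<prec> two_pow \<zero> \<and> (\<forall>x. x \<prec> \<zero> \<longrightarrow> (x \<in> Ack M s \<longleftrightarrow> P x))"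
    using two_pow_pos not_less_0 by blast
  fix d assume "\<exists>s. s \<prec> two_pow d \<and> (\<forall>x. x \<prec> d \<longrightarrow> (x \<in> Ack M s \<longleftrightarrow> P x))"
  then obtain s where s: "s \<prec> two_pow d" "\<And>x. x \<prec> d \<Longrightarrow> x \<in> Ack M s \<longleftrightarrow> P x" by blast
  have *: "s \<oplus> two_pow d \<prec> two_pow (d \<oplus> \<one>)" unfolding two_pow_suc distrib one_mul using s(1) by (rule less_add)
  show "\<exists>s. s \<prec> two_pow (d \<oplus> \<one>) \<and> (\<forall>x. x \<prec> d \<oplus> \<one> \<longrightarrow> (x \<in> Ack M s \<longleftrightarrow> P x))"
  proof (cases "P d")
    case True
    then show ?thesis
      using * s Ack_top[OF s(1)] Ack_add_two_pow by (intro exI[of _ "s \<oplus> two_pow d"]) (auto simp: less_suc)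
  next
    case False
    have "s \<prec> two_pow (d \<oplus> \<one>)" by (rule sr.le_less_trans[OF leq_add *])
    then show ?thesis
      using False s Ack_top[OF s(1)] by (intro exI[of _ s]) (auto simp: less_suc)
  qed
qed

text \<open>If no \<open>s < 2\<^sup>d\<close> worked, collection would bound the counterexamples for all these \<open>s\<close>,
  including the one that codes the bounded approximation of \<open>P\<close>.\<close>

lemma Chong_Mourad:
  assumes J: "dfn (\<lambda>e. J (e 0) (e 1))" and P: "dfn (\<lambda>e. P (e 0) (e 1))" and Q: "dfn (\<lambda>e. Q (e 0) (e 1))"
    and bound: "\<And>w x. J w x \<Longrightarrow> x \<prec> d"
    and compl: "\<And>v x. J v x \<Longrightarrow> (\<exists>w. Q w x) \<longleftrightarrow> \<not> (\<exists>w. P w x)"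
  shows "\<exists>s. \<forall>v x. J v x \<longrightarrow> (x \<in> Ack M s \<longleftrightarrow> (\<exists>w. P w x))"
proof (rule ccontr)
  assume contr: "\<not> ?thesis"
  \<comment> \<open>\<open>R y s\<close>: the code \<open>s\<close> errs at some \<open>x\<close>,
    and the error is visible from witnesses below \<open>y\<close>.\<close>
  define R where "R y s \<longleftrightarrow> (\<exists>x. x \<prec> d \<and> (\<exists>v. v \<prec> y \<and> J v x) \<and>
    (x \<in> Ack M s \<and> (\<exists>v. v \<prec> y \<and> Q v x) \<or> x \<notin> Ack M s \<and> (\<exists>v. v \<prec> y \<and> P v x)))" for y s
  have R: "dfn (\<lambda>e. R (e 0) (e 1))"
    unfolding R_def by (intro dfn_intros dfn_Ack dfn_rel2[OF J] dfn_rel2[OF P] dfn_rel2[OF Q])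
  have "\<exists>y. R y s" for s
  proof -
    from contr obtain v x where v: "J v x" and x: "x \<in> Ack M s \<longleftrightarrow> \<not> (\<exists>w. P w x)" by blast
    obtain w where w: "x \<in> Ack M s \<and> Q w x \<or> x \<notin> Ack M s \<and> P w x" using x compl[OF v] by blast
    have "v \<prec> v \<oplus> w \<oplus> \<one>" "w \<prec> v \<oplus> w \<oplus> \<one>" unfolding less_suc_leq by (rule leq_add leq_add2)+
    with v w bound[OF v] have "R (v \<oplus> w \<oplus> \<one>) s" unfolding R_def by blast
    then show ?thesis by blast
  qed
  then obtain b where b: "\<And>s. s \<prec> two_pow d \<Longrightarrow> \<exists>y. y \<prec> b \<and> R y s"
    using collection[OF R, of "two_pow d"] by blast
  have "dfn (\<lambda>e. \<exists>v. v \<prec> b \<and> P v (e 0))" by (intro dfn_intros dfn_rel2[OF P])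
  from coded_bounded[OF this, of d] obtain s where s: "s \<prec> two_pow d"
    "\<And>x. x \<prec> d \<Longrightarrow> x \<in> Ack M s \<longleftrightarrow> (\<exists>v. v \<prec> b \<and> P v x)" by blast
  from b[OF s(1)] obtain y where "y \<prec> b" "R y s" by blast
  \<comment> \<open>\<open>R\<close> is monotone in \<open>y\<close>. Now \<open>s\<close> agrees
    with \<open>P\<close> restricted to witnesses below \<open>b\<close>: an error of the first kind
    would give \<open>x\<close> witnesses for both \<open>P\<close> and \<open>Q\<close>, one of the
    second kind would put \<open>x\<close> into \<open>Ack M s\<close>.\<close>
  then have "R b s" unfolding R_def using less_trans by blast
  then show False unfolding R_def using s(2) compl by blast
qed

section \<open>Definable cuts\<close>

lemma least_dfn:
  assumes "dfn (\<lambda>e. P (e 0))" "P x"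
  obtains m where "P m" "\<And>y. y \<prec> m \<Longrightarrow> \<not> P y"
proof -
  have "\<exists>m. P m \<and> (\<forall>y. y \<prec> m \<longrightarrow> \<not> P y)"
  proof (rule ccontr)
    assume no: "\<not> ?thesis"
    have "\<forall>y. y \<prec> n \<longrightarrow> \<not> P y" for n
    proof (rule induct_dfn[where x = n])
      show "dfn (\<lambda>e. \<forall>y. y \<prec> e 0 \<longrightarrow> \<not> P y)"
        by (intro dfn_intros dfn_rel1[OF assms(1)])
    qed (use no not_less_0 less_suc in blast)+
    then have "\<not> P x" using less_suc[of x x] by blast
    with assms(2) show False by blast
  qed
  then show thesis using that by blast
qed

text \<open>The way back from the layout of \<open>Sigma1_definable\<close> to the interleaved
  one.\<close>

lemma dfn_sat2: "set_env M E \<Longrightarrow> dfn (\<lambda>e. sat M (e 0 \<triangleright> e 1 \<triangleright> p) E \<phi>)"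
proof (rule dfnI[of E _ p])
  let ?r = "case_nat 0 (case_nat 2 (\<lambda>i. Suc (2 * i)))"
  fix e
  have "(\<lambda>i. ilv e p (?r i)) = e 0 \<triangleright> e 1 \<triangleright> p"
    by (rule ext) (auto simp: ilv_def split: nat.splits)
  then show "sat M (e 0 \<triangleright> e 1 \<triangleright> p) E \<phi> \<longleftrightarrow> sat M (ilv e p) E (ren ?r id \<phi>)"
    by (simp only: sat_ren id_apply)
qed

end

text \<open>The enumeration is given as a graph, since its domain \<open>I\<close> is not a set of
  the structure. \<open>G_leq\<close> turns searches for preimages into bounded ones.\<close>

locale enumerated_cut = rca M for M :: "('a, 'b) L2_structure_scheme" (structure) +
  fixes I :: "'a set" and G :: "'a \<Rightarrow> 'a \<Rightarrow> bool"
  assumes cut: "proper_cut M I"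
    and dfn_G: "dfn (\<lambda>e. G (e 0) (e 1))"
    and G_I: "G i w \<Longrightarrow> i \<in> I" and G_ex: "i \<in> I \<Longrightarrow> \<exists>w. G i w"
    and G_unique: "G i w \<Longrightarrow> G i w' \<Longrightarrow> w = w'"
    and G_less: "G i w \<Longrightarrow> G i' w' \<Longrightarrow> i \<prec> i' \<Longrightarrow> w \<prec> w'"
    and G_leq: "G i w \<Longrightarrow> i \<preceq> w" and G_cofinal: "\<exists>i w. G i w \<and> b \<preceq> w"

context rca
begin

text \<open>Up to the summand \<open>i\<close>, which makes it strictly increasing, the map sends \<open>i\<close> to the least
  bound for the witnesses of \<open>0, \<dots>, i \<in> I\<close>; a bound for all its values would make \<open>I\<close> a
  \<open>\<Delta>\<^sup>0\<^sub>0\<close> set violating induction.\<close>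

lemma ex_enumerated_cut:
  assumes cut: "proper_cut M I" and "Sigma1_definable M I"
  obtains G where "enumerated_cut M I G"
proof -
  obtain \<phi> p E where \<phi>: "set_env M E" "I = {x. sat_Sigma1 M (x \<triangleright> p) E \<phi>}"
    using assms(2) unfolding Sigma1_definable_def by blast
  define J where "J w x \<longleftrightarrow> sat M (w \<triangleright> x \<triangleright> p) E \<phi>" for w x
  have I: "x \<in> I \<longleftrightarrow> (\<exists>w. J w x)" for x by (simp add: \<phi>(2) J_def sat_Sigma1_def)
  have J: "dfn (\<lambda>e. J (e 0) (e 1))" unfolding J_def by (rule dfn_sat2[OF \<phi>(1)])
  have down: "y \<in> I" if "x \<in> I" "y \<preceq> x" for x y
    using cut that unfolding proper_cut_def leq_def by blast
  define B where "B w i \<longleftrightarrow> (\<forall>x. x \<prec> i \<oplus> \<one> \<longrightarrow> (\<exists>v. v \<prec> w \<oplus> \<one> \<and> J v x))" for w i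
  have B: "dfn (\<lambda>e. B (e 0) (e 1))" unfolding B_def by (intro dfn_intros dfn_rel2[OF J])
  define L where "L i u \<longleftrightarrow> B u i \<and> (\<forall>v. v \<prec> u \<longrightarrow> \<not> B v i)" for i u
  have L: "dfn (\<lambda>e. L (e 0) (e 1))" unfolding L_def by (intro dfn_intros dfn_rel2[OF B])
  have L_ex: "\<exists>u. L i u" if "i \<in> I" for i
  proof -
    \<comment> \<open>Everything up to \<open>i\<close> lies in the cut and so has a witness;
      collection then bounds these witnesses jointly.\<close>
    have "\<exists>v. J v x" if "x \<prec> i \<oplus> \<one>" for x
      using down[OF \<open>i \<in> I\<close>] that unfolding less_suc_leq I by blast
    from collection[OF J this] obtain b where b: "\<And>x. x \<prec> i \<oplus> \<one> \<Longrightarrow> \<exists>v. v \<prec> b \<and> J v x" by blast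
    then have "B b i" unfolding B_def less_suc by blast
    from least_dfn[OF dfn_rel2[OF B fn_proj fn_const, of 0 i], OF this] show ?thesis
      unfolding L_def by blast
  qed
  have L_mono: "u \<preceq> u'" if "L i u" "L i' u'" "i \<preceq> i'" for i i' u u'
  proof -
    have "x \<preceq> i'" if "x \<preceq> i" for x using that \<open>i \<preceq> i'\<close> by (rule leq_trans)
    then have "B u' i" using that(2) unfolding L_def B_def less_suc_leq by blast
    then have "\<not> u' \<prec> u" using that(1) unfolding L_def by blast
    then show ?thesis using less_total[of u u'] unfolding leq_def by blast
  qed
  \<comment> \<open>The sum dominates both summands: the bound on \<open>u\<close> makes the graph
    Delta0, and \<open>i \<preceq> w\<close> is \<open>G_leq\<close>.\<close>
  define G where "G i w \<longleftrightarrow> (\<exists>u. u \<prec> w \<oplus> \<one> \<and> w = u \<oplus> i \<and> L i u)" for i w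
  have G: "G i w \<longleftrightarrow> (\<exists>u. w = u \<oplus> i \<and> L i u)" for i w
    unfolding G_def less_suc_leq using leq_add by blast
  have L_I: "i \<in> I" if "L i u" for i u
    using that leq_refl[of i] unfolding L_def B_def less_suc_leq I by blast
  show thesis
  proof (rule that, unfold_locales)
    show "proper_cut M I" by (rule cut)
    show "dfn (\<lambda>e. G (e 0) (e 1))" unfolding G_def by (intro dfn_intros dfn_rel2[OF L])
    show "i \<in> I" if "G i w" for i w using that L_I unfolding G by blast
    show "\<exists>w. G i w" if "i \<in> I" for i using L_ex[OF that] unfolding G by blast
    show "w = w'" if "G i w" "G i w'" for i w w'
      using that L_mono[OF _ _ leq_refl] leq_antisym unfolding G by metis
    show "w \<prec> w'" if ww: "G i w" "G i' w'" "i \<prec> i'" for i i' w w'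
    proof -
      obtain u where u: "w = u \<oplus> i" "L i u" using ww(1) unfolding G by blast
      obtain u' where u': "w' = u' \<oplus> i'" "L i' u'" using ww(2) unfolding G by blast
      have "i \<preceq> i'" using ww(3) unfolding leq_def by blast
      with u u' have "u \<preceq> u'" using L_mono by blast
      then show ?thesis unfolding u u' using ww(3) by (rule sr.add_le_less_mono)
    qed
    show "i \<preceq> w" if "G i w" for i w using that leq_add2 unfolding G by blast
    show "\<exists>i w. G i w \<and> b \<preceq> w" for b
    proof (rule ccontr)
      assume "\<not> ?thesis"
      then have w: "w \<prec> b" if "G i w" for i w using that less_iff leq_total by blast
      have I': "x \<in> I \<longleftrightarrow> (\<exists>v. v \<prec> b \<and> J v x)" for x
      proof
        assume "x \<in> I"
        then obtain u where u: "L x u" using L_ex by blast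
        then obtain v where v: "v \<preceq> u" "J v x" using leq_refl unfolding L_def B_def less_suc_leq by blast
        have "u \<oplus> x \<prec> b" using u w unfolding G by blast
        then have "v \<prec> b" using v(1) leq_add[of u x] sr.le_less_trans leq_trans by blast
        with v(2) show "\<exists>v. v \<prec> b \<and> J v x" by blast
      qed (use I in blast)
      have "x \<in> I" for x
      proof (rule induct_dfn[where x = x])
        show "dfn (\<lambda>e. e 0 \<in> I)" unfolding I' by (intro dfn_intros dfn_rel2[OF J])
      qed (use cut in \<open>auto simp: proper_cut_def\<close>)
      then show False using cut unfolding proper_cut_def by blast
    qed
  qed
qed

text \<open>Codes of tuples from \<open>I\<close> may leave the cut, but remain bounded in
  \<open>M\<close>, as \<open>Chong_Mourad\<close> requires.\<close>

lemma tuple_bounded: "\<exists>b. \<forall>ys. length ys = m \<longrightarrow> (\<forall>y\<in>set ys. y \<prec> d) \<longrightarrow> tuple M ys \<prec> b"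
proof (induction m)
  case 0
  then show ?case by (intro exI[of _ \<one>]) (simp add: zero_less_one)
next
  case (Suc m)
  then obtain b where b: "\<And>ys. length ys = m \<Longrightarrow> \<forall>y\<in>set ys. y \<prec> d \<Longrightarrow> tuple M ys \<prec> b" by blast
  show ?case
  proof (cases m)
    case 0
    then have "tuple M ys \<prec> d" if "length ys = Suc m" "\<forall>y\<in>set ys. y \<prec> d" for ys
      using that by (auto simp: length_Suc_conv)
    then show ?thesis by blast
  next
    case (Suc m')
    have "tuple M ys \<prec> pair M d b" if len: "length ys = Suc m" and bd: "\<forall>y\<in>set ys. y \<prec> d" for ys
    proof -
      obtain y zs where ys: "ys = y # zs" "length zs = m" using len by (cases ys) auto
      then obtain z zs' where "zs = z # zs'" using Suc by (cases zs) auto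
      then have "tuple M ys = pair M y (tuple M zs)" using ys by simp
      moreover have "y \<oplus> tuple M zs \<prec> d \<oplus> b"
        using bd ys b[of zs] by (intro sr.add_strict_mono) auto
      ultimately show ?thesis using pair_less by simp
    qed
    then show ?thesis by blast
  qed
qed

lemma std_Suc: "std M (Suc c) = std M c \<oplus> \<one>" and std_0: "std M 0 = \<zero>"
  by (simp_all add: std_def)

lemma std_less: "c < c' \<Longrightarrow> std M c \<prec> std M c'"
  by (induction c') (auto simp: std_Suc less_suc less_Suc_eq)

lemma dfn_finite:
  assumes "finite S" "fn f"
  shows "dfn (\<lambda>e. f e \<in> S)"
  using assms(1) by induction (simp_all add: dfn_bool dfn_disj dfn_eq assms(2) fn_const)

lemma mem_colouring_graph:
  assumes "length xs = n"
  shows "tuple M (xs @ [c]) \<in> colouring_graph M A n f \<longleftrightarrow>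
    set xs \<subseteq> A \<and> sorted_wrt (\<prec>) xs \<and> c = std M (f xs)"
proof -
  have *: "ys = xs \<and> b = c" if "length ys = n" "tuple M (xs @ [c]) = tuple M (ys @ [b])" for ys b
    using that assms tuple_inject[of "xs @ [c]" "ys @ [b]"] by simp
  show ?thesis
  proof
    assume "tuple M (xs @ [c]) \<in> colouring_graph M A n f"
    then obtain ys where "tuple M (xs @ [c]) = tuple M (ys @ [std M (f ys)])" "length ys = n"
      "set ys \<subseteq> A" "sorted_wrt (\<prec>) ys"
      unfolding colouring_graph_def subsets_of_size_def by blast
    then show "set xs \<subseteq> A \<and> sorted_wrt (\<prec>) xs \<and> c = std M (f xs)" using * by blast
  next
    assume "set xs \<subseteq> A \<and> sorted_wrt (\<prec>) xs \<and> c = std M (f xs)"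
    then show "tuple M (xs @ [c]) \<in> colouring_graph M A n f"
      using assms unfolding colouring_graph_def subsets_of_size_def by blast
  qed
qed

lemma colouring_graph_tuple:
  "z \<in> colouring_graph M A n f \<Longrightarrow> \<exists>xs c. length xs = n \<and> z = tuple M (xs @ [c])"
  unfolding colouring_graph_def subsets_of_size_def by blast

end

context enumerated_cut
begin

section \<open>The enumeration \<open>g\<close> of a cofinal subset of \<open>M\<close> and the
  index map \<open>idx\<close>\<close>

lemma cut_down: "x \<in> I \<Longrightarrow> y \<preceq> x \<Longrightarrow> y \<in> I"
  using cut unfolding proper_cut_def leq_def by blast

lemma cut_bounded: "\<exists>d. \<forall>x\<in>I. x \<prec> d"
proof -
  obtain d where "d \<notin> I" using cut unfolding proper_cut_def by blast
  then show ?thesis using cut_down less_total unfolding leq_def by blast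
qed

lemma std_in_cut: "std M c \<in> I"
  using cut by (induction c) (simp_all add: std_0 std_Suc proper_cut_def)

definition g :: "'a \<Rightarrow> 'a" where "g i = (THE w. G i w)"

lemma G_g: "i \<in> I \<Longrightarrow> G i (g i)"
  unfolding g_def by (rule theI') (blast dest: G_ex G_unique)

lemma G_eq: "G i w \<Longrightarrow> w = g i"
  by (rule G_unique[OF _ G_g[OF G_I]])

lemma g_less:
  assumes "i \<in> I" "j \<in> I" "i \<prec> j"
  shows "g i \<prec> g j"
  using assms by (intro G_less[OF G_g G_g])

lemma g_less_iff:
  assumes "i \<in> I" "j \<in> I"
  shows "g i \<prec> g j \<longleftrightarrow> i \<prec> j"
proof
  assume *: "g i \<prec> g j"
  then have "\<not> j \<prec> i" using g_less[OF assms(2,1)] less_trans less_irrefl by blast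
  moreover have "j \<noteq> i" using * less_irrefl by blast
  ultimately show "i \<prec> j" using less_total by blast
qed (rule g_less[OF assms])

lemma sorted_map_g: "set is \<subseteq> I \<Longrightarrow> sorted_wrt (\<prec>) (map g is) \<longleftrightarrow> sorted_wrt (\<prec>) is"
  by (induction "is") (auto simp: g_less_iff subset_eq)

lemma list_all2_G: "list_all2 G is ws \<longleftrightarrow> set is \<subseteq> I \<and> ws = map g is"
proof (induction "is" arbitrary: ws)
  case (Cons i "is")
  then show ?case by (cases ws) (auto dest: G_I G_eq intro: G_g)
qed auto

text \<open>Phrased through \<open>G\<close> with bounded quantifiers instead of through
  \<open>g\<close>. The first conjunct holds vacuously outside \<open>I\<close>, so no test for
  membership in \<open>I\<close> occurs; that the value lies in \<open>I\<close> follows from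
  cofinality.\<close>

definition idx :: "'a \<Rightarrow> 'a" where
  "idx x = (THE i. (\<forall>w. w \<prec> x \<longrightarrow> \<not> G i w) \<and> (\<forall>j. j \<prec> i \<longrightarrow> (\<exists>w. w \<prec> x \<and> G j w)))"

lemma idx_iff:
  "i = idx x \<longleftrightarrow> (\<forall>w. w \<prec> x \<longrightarrow> \<not> G i w) \<and> (\<forall>j. j \<prec> i \<longrightarrow> (\<exists>w. w \<prec> x \<and> G j w))"
  (is "_ \<longleftrightarrow> ?L i")
proof -
  have dfn: "dfn (\<lambda>e. \<forall>w. w \<prec> x \<longrightarrow> \<not> G (e 0) w)" by (intro dfn_intros dfn_rel2[OF dfn_G])
  \<comment> \<open>By \<open>G_leq\<close>, \<open>x\<close> itself is a candidate, so a least one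
    exists.\<close>
  have "\<forall>w. w \<prec> x \<longrightarrow> \<not> G x w" using G_leq less_iff by blast
  with dfn obtain m where "\<forall>w. w \<prec> x \<longrightarrow> \<not> G m w" "\<And>j. j \<prec> m \<Longrightarrow> \<not> (\<forall>w. w \<prec> x \<longrightarrow> \<not> G j w)"
    by (rule least_dfn) blast
  then have m: "?L m" by blast
  have u: "i = j" if "?L i" "?L j" for i j using that less_total[of i j] by blast
  then have "idx x = m" unfolding idx_def using m by (intro the_equality) blast+
  then show ?thesis using u m by blast
qed

lemma idx_leqI: "\<forall>w. w \<prec> x \<longrightarrow> \<not> G i w \<Longrightarrow> idx x \<preceq> i"
  using idx_iff[of "idx x" x] less_total[of "idx x" i] unfolding leq_def by blast

lemma idx_G: "G (idx x) w \<Longrightarrow> x \<preceq> w"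
  using idx_iff[of "idx x" x] less_total[of x w] unfolding leq_def by blast

lemma idx_leq: "idx x \<preceq> x"
  using G_leq less_iff by (intro idx_leqI) blast

lemma idx_in_cut: "idx x \<in> I"
proof -
  obtain i w where w: "G i w" "x \<preceq> w" using G_cofinal by blast
  then have "idx x \<preceq> i" using G_unique less_iff by (intro idx_leqI) blast
  then show ?thesis using cut_down G_I w(1) by blast
qed

text \<open>Weak monotonicity in contrapositive form: arbitrary preimages of an increasing tuple are
  again increasing.\<close>

lemma idx_less: "idx x \<prec> idx y \<Longrightarrow> x \<prec> y"
proof (rule ccontr)
  assume *: "idx x \<prec> idx y" "\<not> x \<prec> y"
  then have "y \<preceq> x" using less_iff leq_total by blast
  then have "\<not> G (idx x) w" if "w \<prec> y" for w
    using idx_G[of x w] leq_trans[of y x w] less_iff[of w y] that by blast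
  then show False using idx_leqI[of y "idx x"] *(1) less_iff by blast
qed

text \<open>Gives cofinality in \<open>I\<close> of the image under \<open>idx\<close> of an
  unbounded set.\<close>

lemma less_idx: "i \<in> I \<Longrightarrow> g i \<prec> x \<Longrightarrow> i \<prec> idx x"
proof (rule ccontr)
  assume *: "i \<in> I" "g i \<prec> x" "\<not> i \<prec> idx x"
  then have "g (idx x) \<preceq> g i"
    using g_less_iff[OF *(1) idx_in_cut[of x]] less_total[of "g (idx x)" "g i"] unfolding leq_def by auto
  moreover have "x \<preceq> g (idx x)" by (rule idx_G[OF G_g[OF idx_in_cut]])
  ultimately show False using *(2) leq_trans less_iff by blast
qed

lemma fn_idx: "fn f \<Longrightarrow> fn (\<lambda>e. idx (f e))"
proof (rule fn_op1[of idx, OF _ idx_leq])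
  show "dfn (\<lambda>e. e 0 = idx (e 1))" unfolding idx_iff by (intro dfn_intros dfn_rel2[OF dfn_G])
qed

section \<open>Transfer of Ramsey's theorem\<close>

lemma tuple_split:
  assumes "length ys = Suc n"
  obtains xs c where "ys = xs @ [c]" "length xs = n"
  using assms by (cases ys rule: rev_cases) auto

lemma utup_tuple_last:
  assumes "length xs = n"
  shows "utup (Suc n) (tuple M (xs @ [c])) = xs @ [c]"
  using utup_tuple[of "xs @ [c]"] assms by simp

text \<open>An application of \<open>Chong_Mourad\<close> to the codes of tuples over
  \<open>I\<close>, split by membership in the graph of the pulled back colouring.\<close>

lemma pullback_coded:
  assumes F: "colouring_graph M UNIV n f \<in> setsM M"
  shows "coded_colouring M I n (\<lambda>is. f (map g is))"
proof -
  let ?F = "colouring_graph M UNIV n f"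
  let ?m = "Suc n"
  \<comment> \<open>A \<open>G\<close>-image of each entry, packed into \<open>v\<close>, certifies
    that the entry lies in \<open>I\<close>.\<close>
  define J where "J v z \<longleftrightarrow> z = tuple M (utup ?m z) \<and> list_all2 G (utup ?m z) (utup ?m v)" for v z
  define P where "P w z \<longleftrightarrow> sorted_wrt (\<prec>) (butlast (utup ?m z)) \<and>
    list_all2 G (butlast (utup ?m z)) (utup n w) \<and> tuple M (utup n w @ [last (utup ?m z)]) \<in> ?F" for w z
  \<comment> \<open>Over \<open>I\<close> the list of images exists and is unique, so once
    \<open>w\<close> supplies it, non-membership in \<open>?F\<close> is witnessed in the same way
    as membership.\<close>
  define Q where "Q w z \<longleftrightarrow> \<not> sorted_wrt (\<prec>) (butlast (utup ?m z)) \<or>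
    list_all2 G (butlast (utup ?m z)) (utup n w) \<and> tuple M (utup n w @ [last (utup ?m z)]) \<notin> ?F" for w z
  have J: "dfn (\<lambda>e. J (e 0) (e 1))"
    unfolding J_def by (intro dfn_intros dfn_list_all2[OF dfn_G] fn_tuple fnl_utup)
  have P: "dfn (\<lambda>e. P (e 0) (e 1))"
    unfolding P_def by (intro dfn_intros dfn_sorted dfn_list_all2[OF dfn_G] dfn_mem[OF F]
        fn_tuple fnl_append fnl_butlast fnl_Cons fnl_Nil fn_last fnl_utup)
  have Q: "dfn (\<lambda>e. Q (e 0) (e 1))"
    unfolding Q_def by (intro dfn_intros dfn_sorted dfn_list_all2[OF dfn_G] dfn_mem[OF F]
        fn_tuple fnl_append fnl_butlast fnl_Cons fnl_Nil fn_last fnl_utup)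
  have J_iff: "(\<exists>v. J v z) \<longleftrightarrow> (\<exists>xs c. length xs = n \<and> set xs \<subseteq> I \<and> c \<in> I \<and> z = tuple M (xs @ [c]))" for z
  proof
    assume "\<exists>v. J v z"
    then obtain v where v: "z = tuple M (utup ?m z)" "set (utup ?m z) \<subseteq> I"
      unfolding J_def list_all2_G by blast
    obtain xs c where "utup ?m z = xs @ [c]" "length xs = n" by (rule tuple_split[OF length_utup])
    with v show "\<exists>xs c. length xs = n \<and> set xs \<subseteq> I \<and> c \<in> I \<and> z = tuple M (xs @ [c])"
      by (intro exI[of _ xs] exI[of _ c]) auto
  next
    assume "\<exists>xs c. length xs = n \<and> set xs \<subseteq> I \<and> c \<in> I \<and> z = tuple M (xs @ [c])"
    then obtain xs c where z: "length xs = n" "set xs \<subseteq> I" "c \<in> I" "z = tuple M (xs @ [c])" by blast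
    then have "J (tuple M (map g (xs @ [c]))) z"
      using utup_tuple_last[of xs n c] utup_tuple[of "map g (xs @ [c])"]
      unfolding J_def list_all2_G by simp
    then show "\<exists>v. J v z" by blast
  qed
  have PQ: "(\<exists>w. P w z) \<longleftrightarrow> sorted_wrt (\<prec>) xs \<and> tuple M (map g xs @ [c]) \<in> ?F"
    "(\<exists>w. Q w z) \<longleftrightarrow> \<not> (sorted_wrt (\<prec>) xs \<and> tuple M (map g xs @ [c]) \<in> ?F)"
    if z: "length xs = n" "set xs \<subseteq> I" "z = tuple M (xs @ [c])" for xs c z
  proof -
    have u: "utup ?m z = xs @ [c]" unfolding z(3) using z(1) by (rule utup_tuple_last)
    have w: "utup n (tuple M (map g xs)) = map g xs" using utup_tuple[of "map g xs"] z(1) by simp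
    have P': "P w z \<longleftrightarrow> sorted_wrt (\<prec>) xs \<and> utup n w = map g xs \<and> tuple M (map g xs @ [c]) \<in> ?F" for w
      unfolding P_def u list_all2_G using z(2) by auto
    have Q': "Q w z \<longleftrightarrow> \<not> sorted_wrt (\<prec>) xs \<or> utup n w = map g xs \<and> tuple M (map g xs @ [c]) \<notin> ?F" for w
      unfolding Q_def u list_all2_G using z(2) by auto
    show "(\<exists>w. P w z) \<longleftrightarrow> sorted_wrt (\<prec>) xs \<and> tuple M (map g xs @ [c]) \<in> ?F"
      "(\<exists>w. Q w z) \<longleftrightarrow> \<not> (sorted_wrt (\<prec>) xs \<and> tuple M (map g xs @ [c]) \<in> ?F)"
      unfolding P' Q' using w by blast+
  qed
  obtain d where d: "\<forall>x\<in>I. x \<prec> d" using cut_bounded by blast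
  obtain b where b: "\<And>ys. length ys = ?m \<Longrightarrow> \<forall>y\<in>set ys. y \<prec> d \<Longrightarrow> tuple M ys \<prec> b"
    using tuple_bounded[of ?m d] by blast
  have "\<exists>s. \<forall>v z. J v z \<longrightarrow> (z \<in> Ack M s \<longleftrightarrow> (\<exists>w. P w z))"
  proof (rule Chong_Mourad[OF J P Q])
    fix v z assume "J v z"
    then obtain xs c where z: "length xs = n" "set xs \<subseteq> I" "c \<in> I" "z = tuple M (xs @ [c])"
      using J_iff by blast
    show "z \<prec> b" unfolding z(4) using z d by (intro b) auto
    show "(\<exists>w. Q w z) \<longleftrightarrow> \<not> (\<exists>w. P w z)" using PQ[OF z(1,2,4)] by blast
  qed
  then obtain s where s: "\<And>v z. J v z \<Longrightarrow> z \<in> Ack M s \<longleftrightarrow> (\<exists>w. P w z)" by blast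
  let ?C = "colouring_graph M I n (\<lambda>is. f (map g is))"
  have C: "tuple M (xs @ [c]) \<in> ?C \<longleftrightarrow> tuple M (xs @ [c]) \<in> Ack M s"
    if z: "length xs = n" "set xs \<subseteq> I" "c \<in> I" for xs c
  proof -
    have "(\<exists>v. J v (tuple M (xs @ [c])))" unfolding J_iff using z by blast
    then have "tuple M (xs @ [c]) \<in> Ack M s \<longleftrightarrow> sorted_wrt (\<prec>) xs \<and> tuple M (map g xs @ [c]) \<in> ?F"
      using s PQ(1)[OF z(1,2) refl] by blast
    then show ?thesis
      unfolding mem_colouring_graph[OF z(1)] mem_colouring_graph[of "map g xs", simplified, OF z(1)]
      using z(2) sorted_map_g[OF z(2)] by blast
  qed
  have "?C = Ack M s \<inter> tuple M ` {ys. length ys = n + 1 \<and> set ys \<subseteq> I}"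
  proof (intro set_eqI iffI)
    fix z assume z: "z \<in> ?C"
    obtain xs c where xs: "length xs = n" "z = tuple M (xs @ [c])"
      using colouring_graph_tuple[OF z] by blast
    have I: "set xs \<subseteq> I" "c \<in> I"
      using z std_in_cut unfolding xs(2) mem_colouring_graph[OF xs(1)] by auto
    show "z \<in> Ack M s \<inter> tuple M ` {ys. length ys = n + 1 \<and> set ys \<subseteq> I}"
      using z xs I C[OF xs(1) I] by auto
  next
    fix z assume z: "z \<in> Ack M s \<inter> tuple M ` {ys. length ys = n + 1 \<and> set ys \<subseteq> I}"
    then obtain ys where ys: "length ys = Suc n" "set ys \<subseteq> I" "z = tuple M ys" by auto
    obtain xs c where xs: "ys = xs @ [c]" "length xs = n" by (rule tuple_split[OF ys(1)])
    have "set xs \<subseteq> I" "c \<in> I" using ys(2) xs(1) by auto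
    from C[OF xs(2) this] show "z \<in> ?C" using z unfolding ys(3) xs(1) by blast
  qed
  then show ?thesis unfolding coded_colouring_def by blast
qed

lemma models_if_cut_models:
  assumes "cut_models_RT M I n k"
  shows "models_RT M n k"
  unfolding models_RT_def ramsey_def
proof (intro allI impI)
  fix f assume k: "\<forall>xs\<in>subsets_of_size M UNIV n. f xs < k"
    and F: "colouring_graph M UNIV n f \<in> setsM M"
  let ?f = "\<lambda>is. f (map g is)"
  have "\<forall>is\<in>subsets_of_size M I n. ?f is < k"
    using k sorted_map_g unfolding subsets_of_size_def by simp
  moreover have "(\<forall>is\<in>subsets_of_size M I n. ?f is < k) \<longrightarrow> coded_colouring M I n ?f \<longrightarrow>
      (\<exists>H\<in>Cod M I. H \<subseteq> I \<and> (\<forall>x\<in>I. \<exists>y\<in>H. x \<prec> y \<or> x = y) \<and>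
        (\<exists>c<k. \<forall>is\<in>subsets_of_size M H n. ?f is = c))"
    using assms unfolding cut_models_RT_def ramsey_def by (rule spec)
  ultimately obtain H c where H: "H \<in> Cod M I" "H \<subseteq> I"
    "\<forall>x\<in>I. \<exists>y\<in>H. x \<prec> y \<or> x = y" "c < k" "\<forall>is\<in>subsets_of_size M H n. ?f is = c"
    using pullback_coded[OF F] by blast
  obtain s where s: "H = Ack M s \<inter> I" using H(1) unfolding Cod_def by blast
  \<comment> \<open>\<open>H\<close> need not be a set of the structure, but its image is:
    \<open>G i x\<close> already forces \<open>i\<close> into \<open>I\<close>, so
    \<open>Ack M s\<close> may replace \<open>H\<close>, and \<open>G_leq\<close> bounds
    \<open>i\<close>.\<close>
  have "g ` H = {x. \<exists>i. i \<prec> x \<oplus> \<one> \<and> G i x \<and> i \<in> Ack M s}"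
    unfolding less_suc_leq s using G_leq G_I G_g G_eq by blast
  also have "\<dots> \<in> setsM M"
    by (rule comprehension) (intro dfn_intros dfn_rel2[OF dfn_G] dfn_Ack)
  finally have "g ` H \<in> setsM M" .
  moreover have "\<exists>y\<in>g ` H. x \<prec> y \<or> x = y" for x
  proof -
    obtain i w where w: "G i w" "x \<preceq> w" using G_cofinal by blast
    obtain j where j: "j \<in> H" "i \<prec> j \<or> i = j" using H(3) G_I[OF w(1)] by blast
    then have "g i \<preceq> g j" using g_less[of i j] G_I[OF w(1)] H(2) unfolding leq_def by blast
    then have "x \<preceq> g j" using w(2) G_eq[OF w(1)] leq_trans by blast
    then show ?thesis using j(1) unfolding leq_def by blast
  qed
  moreover have "f xs = c" if xs: "xs \<in> subsets_of_size M (g ` H) n" for xs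
  proof -
    have "xs \<in> lists (g ` H)" using xs unfolding subsets_of_size_def by auto
    then obtain "is" where "is": "is \<in> lists H" "xs = map g is" unfolding lists_image by blast
    then have "is \<in> subsets_of_size M H n"
      using xs sorted_map_g[of "is"] H(2) unfolding subsets_of_size_def by auto
    then show ?thesis using H(5) "is"(2) by blast
  qed
  ultimately show "\<exists>H\<in>setsM M. H \<subseteq> UNIV \<and> (\<forall>x\<in>UNIV. \<exists>y\<in>H. x \<prec> y \<or> x = y) \<and>
      (\<exists>c<k. \<forall>xs\<in>subsets_of_size M H n. f xs = c)"
    using H(4) by blast
qed

text \<open>Distinct elements may share an index, so some increasing tuples have no increasing index
  tuple and get the colour 0. This does no harm: increasing tuples of indices are lifted only to
  tuples coloured by the first branch.\<close>

definition lift_colouring :: "('a list \<Rightarrow> nat) \<Rightarrow> 'a list \<Rightarrow> nat" where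
  "lift_colouring f xs = (if sorted_wrt (\<prec>) (map idx xs) then f (map idx xs) else 0)"

lemma lift_colouring_graph:
  assumes f: "\<forall>is\<in>subsets_of_size M I n. f is < k" and k: "0 < k" and "coded_colouring M I n f"
  shows "colouring_graph M UNIV n (lift_colouring f) \<in> setsM M"
proof -
  let ?m = "Suc n" and ?S = "std M ` {..<k}"
  obtain s where s: "colouring_graph M I n f = Ack M s \<inter> tuple M ` {ys. length ys = n + 1 \<and> set ys \<subseteq> I}"
    using assms(3) unfolding coded_colouring_def by blast
  \<comment> \<open>\<open>Ack M s\<close> is known to agree with the graph only on tuples from
    \<open>I\<close>; \<open>idx\<close> maps into \<open>I\<close>, and the finitely many colours
    in \<open>?S\<close> are standard, hence in \<open>I\<close>.\<close>
  define P where "P xs c \<longleftrightarrow> sorted_wrt (\<prec>) xs \<and> c \<in> ?S \<and>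
    (if sorted_wrt (\<prec>) (map idx xs) then tuple M (map idx xs @ [c]) \<in> Ack M s else c = \<zero>)" for xs c
  have "tuple M (xs @ [c]) \<in> colouring_graph M UNIV n (lift_colouring f) \<longleftrightarrow> P xs c" if n: "length xs = n" for xs c
  proof (cases "sorted_wrt (\<prec>) (map idx xs)")
    case True
    have sub: "set (map idx xs) \<subseteq> I" using idx_in_cut by auto
    have len: "length (map idx xs) = n" using n by simp
    have "f (map idx xs) < k" using f True sub len unfolding subsets_of_size_def by blast
    moreover have "tuple M (map idx xs @ [c]) \<in> Ack M s \<longleftrightarrow> c = std M (f (map idx xs))" if "c \<in> ?S"
    proof -
      have "c \<in> I" using that std_in_cut by auto
      then have "tuple M (map idx xs @ [c]) \<in> Ack M s \<longleftrightarrow> tuple M (map idx xs @ [c]) \<in> colouring_graph M I n f"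
        unfolding s using sub len by auto
      then show ?thesis unfolding mem_colouring_graph[OF len] using True sub by blast
    qed
    ultimately show ?thesis
      unfolding mem_colouring_graph[OF n] P_def lift_colouring_def using True by auto
  next
    case False
    have "\<zero> \<in> ?S" using k std_0 by (metis imageI lessThan_iff)
    then show ?thesis
      unfolding mem_colouring_graph[OF n] P_def lift_colouring_def using False std_0 by auto
  qed
  then have "colouring_graph M UNIV n (lift_colouring f) =
      {z. \<exists>xs c. length xs = n \<and> z = tuple M (xs @ [c]) \<and> P xs c}"
    using colouring_graph_tuple by blast
  also have "\<dots> = {z. z = tuple M (utup ?m z) \<and> P (butlast (utup ?m z)) (last (utup ?m z))}"
  proof (intro Collect_cong iffI)
    fix z assume "\<exists>xs c. length xs = n \<and> z = tuple M (xs @ [c]) \<and> P xs c"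
    then obtain xs c where z: "length xs = n" "z = tuple M (xs @ [c])" "P xs c" by blast
    have "utup ?m z = xs @ [c]" unfolding z(2) using z(1) by (rule utup_tuple_last)
    with z show "z = tuple M (utup ?m z) \<and> P (butlast (utup ?m z)) (last (utup ?m z))" by simp
  next
    fix z assume z: "z = tuple M (utup ?m z) \<and> P (butlast (utup ?m z)) (last (utup ?m z))"
    obtain xs c where "utup ?m z = xs @ [c]" "length xs = n" by (rule tuple_split[OF length_utup])
    with z show "\<exists>xs c. length xs = n \<and> z = tuple M (xs @ [c]) \<and> P xs c" by auto
  qed
  also have "\<dots> \<in> setsM M"
    unfolding P_def if_bool_eq_conj
    by (rule comprehension)
       (intro dfn_intros dfn_sorted dfn_finite dfn_Ack finite_imageI finite_lessThan
        fn_tuple fnl_append fnl_butlast fnl_Cons fnl_Nil fn_last fnl_utup fnl_map[of idx] fn_idx)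
  finally show ?thesis .
qed

lemma cut_models_if_models:
  assumes "models_RT M n k"
  shows "cut_models_RT M I n k"
  unfolding cut_models_RT_def ramsey_def
proof (intro allI impI)
  fix f assume f: "\<forall>is\<in>subsets_of_size M I n. f is < k" and coded: "coded_colouring M I n f"
  \<comment> \<open>One increasing \<open>n\<close>-tuple in \<open>I\<close> forces
    \<open>0 < k\<close>, so the default colour 0 is admissible.\<close>
  have "map (std M) [0..<n] \<in> subsets_of_size M I n"
    unfolding subsets_of_size_def using std_in_cut std_less by (auto simp: sorted_wrt_map intro: sorted_wrt_mono_rel[OF _ sorted_wrt_upt])
  then have k: "0 < k" using f by auto
  have "lift_colouring f xs < k" if "xs \<in> subsets_of_size M UNIV n" for xs
  proof (cases "sorted_wrt (\<prec>) (map idx xs)")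
    case True
    then have "map idx xs \<in> subsets_of_size M I n"
      using that idx_in_cut unfolding subsets_of_size_def by auto
    then show ?thesis using f True unfolding lift_colouring_def by simp
  qed (use k in \<open>simp add: lift_colouring_def\<close>)
  moreover have "(\<forall>xs\<in>subsets_of_size M UNIV n. lift_colouring f xs < k) \<longrightarrow>
      colouring_graph M UNIV n (lift_colouring f) \<in> setsM M \<longrightarrow>
      (\<exists>H\<in>setsM M. H \<subseteq> UNIV \<and> (\<forall>x\<in>UNIV. \<exists>y\<in>H. x \<prec> y \<or> x = y) \<and>
        (\<exists>c<k. \<forall>xs\<in>subsets_of_size M H n. lift_colouring f xs = c))"
    using assms unfolding models_RT_def ramsey_def by (rule spec)
  ultimately obtain H c where H: "H \<in> setsM M"
    "\<forall>x\<in>UNIV. \<exists>y\<in>H. x \<prec> y \<or> x = y" "c < k" "\<forall>xs\<in>subsets_of_size M H n. lift_colouring f xs = c"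
    using lift_colouring_graph[OF f k coded] by blast
  define P where "P w x \<longleftrightarrow> w \<in> H \<and> x = idx w" for w x
  \<comment> \<open>By \<open>idx_G\<close> every \<open>y\<close> with index \<open>x\<close> is at
    most \<open>g x\<close>. Once \<open>w = g x\<close> is found, absence of \<open>x\<close> from
    the image of \<open>H\<close> is a bounded statement.\<close>
  define Q where "Q w x \<longleftrightarrow> G x w \<and> (\<forall>y. y \<prec> w \<oplus> \<one> \<longrightarrow> \<not> (y \<in> H \<and> x = idx y))" for w x
  obtain d where d: "\<forall>x\<in>I. x \<prec> d" using cut_bounded by blast
  have "\<exists>s. \<forall>v x. G x v \<longrightarrow> (x \<in> Ack M s \<longleftrightarrow> (\<exists>w. P w x))"
  proof (rule Chong_Mourad[where J = "\<lambda>v x. G x v"])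
    show "dfn (\<lambda>e. G (e 1) (e 0))" by (intro dfn_rel2[OF dfn_G] fn_proj)
    show "dfn (\<lambda>e. P (e 0) (e 1))" unfolding P_def by (intro dfn_intros dfn_mem[OF H(1)] fn_idx)
    show "dfn (\<lambda>e. Q (e 0) (e 1))" unfolding Q_def
      by (intro dfn_intros dfn_rel2[OF dfn_G] dfn_mem[OF H(1)] fn_idx)
    fix v x assume v: "G x v"
    then show "x \<prec> d" using G_I d by blast
    show "(\<exists>w. Q w x) \<longleftrightarrow> \<not> (\<exists>w. P w x)"
      using v idx_G unfolding Q_def P_def less_suc_leq by blast
  qed
  then obtain s where s: "\<And>v x. G x v \<Longrightarrow> x \<in> Ack M s \<longleftrightarrow> (\<exists>w. P w x)" by blast
  have eq: "Ack M s \<inter> I = idx ` H"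
    using s[OF G_g] idx_in_cut unfolding P_def by auto
  have "Ack M s \<inter> I \<in> Cod M I" unfolding Cod_def by blast
  moreover have "\<exists>y\<in>Ack M s \<inter> I. x \<prec> y \<or> x = y" if "x \<in> I" for x
  proof -
    obtain y where y: "y \<in> H" "g x \<oplus> \<one> \<preceq> y" using H(2) unfolding leq_def by blast
    have "g x \<prec> y" using y(2) sr.less_le_trans[of "g x" "g x \<oplus> \<one>" y] by (simp add: less_suc)
    then have "x \<prec> idx y" using that by (intro less_idx)
    then show ?thesis unfolding eq using y(1) by blast
  qed
  moreover have "f is = c" if "is": "is \<in> subsets_of_size M (Ack M s \<inter> I) n" for "is"
  proof -
    have "is \<in> lists (idx ` H)" using "is" unfolding subsets_of_size_def eq by auto
    \<comment> \<open>Preimages are chosen entrywise and independently; \<open>idx_less\<close> then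
      puts them in increasing order.\<close>
    then obtain xs where xs: "xs \<in> lists H" "is = map idx xs" unfolding lists_image by blast
    have sorted: "sorted_wrt (\<prec>) (map idx xs)" using "is" xs(2) unfolding subsets_of_size_def by blast
    then have "sorted_wrt (\<prec>) xs"
      unfolding sorted_wrt_map by (rule sorted_wrt_mono_rel[rotated]) (rule idx_less)
    then have "xs \<in> subsets_of_size M H n" using "is" xs unfolding subsets_of_size_def by auto
    then have "lift_colouring f xs = c" using H(4) by blast
    then show ?thesis using sorted xs(2) unfolding lift_colouring_def by simp
  qed
  ultimately show "\<exists>H\<in>Cod M I. H \<subseteq> I \<and> (\<forall>x\<in>I. \<exists>y\<in>H. x \<prec> y \<or> x = y) \<and>
      (\<exists>c<k. \<forall>is\<in>subsets_of_size M H n. f is = c)"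
    using H(3) by blast
qed

end

theorem theorem2p3:
  fixes M :: "'a L2_structure" and I :: "'a set" and n k :: nat
  assumes "RCA0_star M"
    and "proper_cut M I"
    and "Sigma1_definable M I"
  shows "models_RT M n k \<longleftrightarrow> cut_models_RT M I n k"
proof -
  interpret rca M by unfold_locales (rule assms(1))
  obtain G where "enumerated_cut M I G" using assms(2,3) by (rule ex_enumerated_cut)
  then interpret enumerated_cut M I G .
  show ?thesis using models_if_cut_models cut_models_if_models by blast
qed

end
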